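(* Let $D\in\mathcal D_{n,k,2}$. Label the edges of the southeast border of $D$ by $1,\dots,n$ from northeast to southwest, and let $s_1<\dots<s_k$ be the labels of the vertical steps. Let $V\in\mathrm{Gr}_{k,n}$. Then $V\in S_D$ if and only if $V$ has a basis $\{v^{(1)},\dots,v^{(k)}\}\subseteq\mathbb R^n$ such that for all $i\in\{1,\dots,k\}$: * $v^{(i)}_j=0$ for all $j\ne s_i,\,s_i+1,\,n$; and * $v^{(i)}_{s_i}$, $v^{(i)}_{s_i+1}$, and $(-1)^{k-i}v^{(i)}_n$ are all positive.
   Context: $\mathrm{Gr}_{k,n}$ is the real Grassmannian of $k$-dimensional subspaces of $\mathbb R^n$ (row spans of $k\times n$ matrices); $\mathrm{Gr}_{k,n}^{\ge 0}$ is the set of $V$ representable by a matrix all of whose $k\times k$ minors are nonnegative. $[n]=\{1,\dots,n\}$. **Decorated permutations and positroid cells.** A decorated permutation of $[n]$ is a permutation of $[n]$ with each fixed point colored black or white. For $V\in\mathrm{Gr}_{k,n}^{\ge 0}$ represented by a matrix with columns $v_1,\dots,v_n$, put $v_{j+n}=v_j$; the decorated permutation $\pi_V$ sends $i$ to the residue in $[n]$ mod $n$ of the smallest $j\ge i$ with $v_i\in\mathrm{span}(v_{i+1},\dots,v_j)$ (so $j=i$ iff $v_i=0$); a fixed point $i$ is black if $j=i$ and white if $j=i+n$. The positroid cell of $\pi$ is $S_\pi=\{V\in \mathrm{Gr}_{k,n}^{\ge 0}:\pi_V=\pi\}$. **Diagrams.** A $\oplus$-diagram $D$ of type $(k,n)$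 is a filling with symbols $0,+$ of a Young diagram (English notation) inside a $k\times(n-k)$ rectangle. Its decorated permutation $\pi_D$: label the $n$ unit steps of the southeast border of the Young diagram (a lattice path from the northeast to the southwest corner of the rectangle) by $1,\dots,n$, and label each edge of the northwest border by the label of the opposite edge (same row or column) of the southeast border. A pipe starts at each southeast border edge and travels northwest: in a box with $0$ it goes straight; in a box with $+$, a pipe entering through the right edge leaves through the top edge and a pipe entering through the bottom edge leaves through the left edge. If the pipe starting at $i$ ends at $j$, then $\pi_D(i)=j$; a fixed point is black if $i$ labels horizontal edges, white if $i$ labels vertical edges. Put $S_D=S_{\pi_D}$. $\mathcal D_{n,k,2}$ is the set of $\oplus$-diagrams $D$ of type $(k,n)$ such that each of the $k$ rows of $D$ contains at least $2$ boxes, the leftmost and rightmost entries of each row are $+$, and all other entries are $0$. *)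

theory Defs
  imports
    "Jordan_Normal_Form.VS_Connect"
    "Jordan_Normal_Form.Determinant"
    "Jordan_Normal_Form.DL_Submatrix"
begin

(* Vectors and matrices of Jordan_Normal_Form are indexed from 0, whereas the
   coordinates, columns and labels of the mathematics run over [n] = {1..n};
   all functions below take and return the 1-based numbers. *)

abbreviation coord :: "real vec \<Rightarrow> nat \<Rightarrow> real" where
  "coord v j \<equiv> v $ (j - 1)"

section \<open>The totally nonnegative Grassmannian\<close>

abbreviation Rn :: "nat \<Rightarrow> (real, real vec) module" where
  "Rn n \<equiv> module_vec TYPE(real) n"

text \<open>A subspace of \<open>\<real>\<^sup>n\<close>, regarded as a vector space of its own.\<close>

abbreviation subspace_vs :: "nat \<Rightarrow> real vec set \<Rightarrow> (real, real vec) module" where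
  "subspace_vs n V \<equiv> (Rn n)\<lparr>carrier := V\<rparr>"

definition Gr :: "nat \<Rightarrow> nat \<Rightarrow> real vec set set" where
  "Gr k n = {V. VectorSpace.subspace class_ring V (Rn n) \<and>
                vectorspace.dim class_ring (subspace_vs n V) = k}"

definition represents :: "nat \<Rightarrow> nat \<Rightarrow> real mat \<Rightarrow> real vec set \<Rightarrow> bool" where
  "represents k n A V \<longleftrightarrow> A \<in> carrier_mat k n \<and> vec_space.row_space n A = V"

definition Gr_nonneg :: "nat \<Rightarrow> nat \<Rightarrow> real vec set set" where
  "Gr_nonneg k n = {V \<in> Gr k n. \<exists>A. represents k n A V \<and>
     (\<forall>J \<subseteq> {..<n}. card J = k \<longrightarrow> det (submatrix A UNIV J) \<ge> 0)}"

section \<open>Decorated permutations and positroid cells\<close>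

datatype color = Black | White

text \<open>A decorated permutation of \<open>[n]\<close> is a permutation of \<open>[n]\<close> (the identity outside \<open>[n]\<close>)
  together with a coloring whose domain is the set of fixed points in \<open>[n]\<close>. These
  conventions make the representation unique, so that equality of pairs is equality of
  decorated permutations.\<close>

type_synonym dperm = "(nat \<Rightarrow> nat) \<times> (nat \<Rightarrow> color option)"

text \<open>Column \<open>v\<^sub>j\<close> for \<open>j \<ge> 1\<close>, extended by \<open>v\<^bsub>j+n\<^esub> = v\<^sub>j\<close>.\<close>

definition cyc_col :: "nat \<Rightarrow> real mat \<Rightarrow> nat \<Rightarrow> real vec" where
  "cyc_col n A j = col A ((j - 1) mod n)"

definition first_return :: "nat \<Rightarrow> nat \<Rightarrow> real mat \<Rightarrow> nat \<Rightarrow> nat" where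
  "first_return k n A i = (LEAST j. i \<le> j \<and>
     cyc_col n A i \<in> LinearCombinations.module.span class_ring (Rn k) (cyc_col n A ` {i<..j}))"

definition dperm_of_mat :: "nat \<Rightarrow> nat \<Rightarrow> real mat \<Rightarrow> dperm" where
  "dperm_of_mat k n A =
    (\<lambda>i. if i \<in> {1..n} then (first_return k n A i - 1) mod n + 1 else i,
     \<lambda>i. if i \<in> {1..n} \<and> first_return k n A i = i then Some Black
         else if i \<in> {1..n} \<and> first_return k n A i = i + n then Some White
         else None)"

text \<open>Any two representing matrices differ by left multiplication by an invertible matrix,
  so the choice of \<open>A\<close> is immaterial.\<close>

definition dperm_of :: "nat \<Rightarrow> nat \<Rightarrow> real vec set \<Rightarrow> dperm" where
  "dperm_of k n V = dperm_of_mat k n (SOME A. represents k n A V)"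

definition positroid_cell :: "nat \<Rightarrow> nat \<Rightarrow> dperm \<Rightarrow> real vec set set" where
  "positroid_cell k n \<pi> = {V \<in> Gr_nonneg k n. dperm_of k n V = \<pi>}"

section \<open>\<open>\<oplus>\<close>-diagrams\<close>

datatype symbol = Zero | Plus

text \<open>A filled Young diagram is the list of its rows, from top to bottom, each row being
  the list of its entries from left to right. Rows and columns are numbered from 0. Rows of
  length 0 are kept, so a diagram in a rectangle with \<open>k\<close> rows has exactly \<open>k\<close> rows.\<close>

type_synonym diagram = "symbol list list"

definition oplus_diagram :: "nat \<Rightarrow> nat \<Rightarrow> diagram \<Rightarrow> bool" where
  "oplus_diagram k n D \<longleftrightarrow> k \<le> n \<and> length D = k \<and>
     sorted_wrt (\<ge>) (map length D) \<and> (\<forall>row \<in> set D. length row \<le> n - k)"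

text \<open>An edge of the southeast or northwest border is determined by its direction together
  with its row (vertical edges) or column (horizontal edges), so opposite edges of the two
  borders are represented by the same value.\<close>

datatype edge = Vert nat | Horiz nat

text \<open>The lattice path from the northeast to the southwest corner. In \<open>border r w ls\<close>, the
  path is on the top edge of row \<open>r\<close> with \<open>w\<close> columns to its left, and \<open>ls\<close> are the lengths
  of the rows from \<open>r\<close> on.\<close>

fun border :: "nat \<Rightarrow> nat \<Rightarrow> nat list \<Rightarrow> edge list" where
  "border r w [] = map Horiz (rev [0..<w])"
| "border r w (l # ls) = map Horiz (rev [l..<w]) @ Vert r # border (Suc r) l ls"

definition se_border :: "nat \<Rightarrow> nat \<Rightarrow> diagram \<Rightarrow> edge list" where
  "se_border k n D = border 0 (n - k) (map length D)"

definition edge_at :: "nat \<Rightarrow> nat \<Rightarrow> diagram \<Rightarrow> nat \<Rightarrow> edge" where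
  "edge_at k n D i = se_border k n D ! (i - 1)"

definition label_of :: "nat \<Rightarrow> nat \<Rightarrow> diagram \<Rightarrow> edge \<Rightarrow> nat" where
  "label_of k n D e = (THE i. i \<in> {1..n} \<and> edge_at k n D i = e)"

definition vertical_labels :: "nat \<Rightarrow> nat \<Rightarrow> diagram \<Rightarrow> nat set" where
  "vertical_labels k n D = {i \<in> {1..n}. \<exists>r. edge_at k n D i = Vert r}"

text \<open>\<open>pipe_west D r c\<close> is the northwest border edge at which a pipe ends that travels west
  in row \<open>r\<close> with \<open>c\<close> boxes of that row still ahead; \<open>pipe_north D r c\<close> is the same for a
  pipe that travels north in column \<open>c\<close> with \<open>r\<close> boxes of that column still ahead.\<close>

fun pipe_west :: "diagram \<Rightarrow> nat \<Rightarrow> nat \<Rightarrow> edge"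
  and pipe_north :: "diagram \<Rightarrow> nat \<Rightarrow> nat \<Rightarrow> edge" where
  "pipe_west D r 0 = Vert r"
| "pipe_west D r (Suc c) = (if D ! r ! c = Plus then pipe_north D r c else pipe_west D r c)"
| "pipe_north D 0 c = Horiz c"
| "pipe_north D (Suc r) c = (if D ! r ! c = Plus then pipe_west D r c else pipe_north D r c)"

fun pipe_end :: "diagram \<Rightarrow> edge \<Rightarrow> edge" where
  "pipe_end D (Vert r) = pipe_west D r (length (D ! r))"
| "pipe_end D (Horiz c) = pipe_north D (card {r. r < length D \<and> c < length (D ! r)}) c"

definition dperm_of_diagram :: "nat \<Rightarrow> nat \<Rightarrow> diagram \<Rightarrow> dperm" where
  "dperm_of_diagram k n D =
    (let p = (\<lambda>i. if i \<in> {1..n} then label_of k n D (pipe_end D (edge_at k n D i)) else i)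
     in (p, \<lambda>i. if i \<in> {1..n} \<and> p i = i
                then Some (if i \<in> vertical_labels k n D then White else Black)
                else None))"

definition diagram_cell :: "nat \<Rightarrow> nat \<Rightarrow> diagram \<Rightarrow> real vec set set" where
  "diagram_cell k n D = positroid_cell k n (dperm_of_diagram k n D)"

text \<open>The set \<open>\<D>\<^bsub>n,k,2\<^esub>\<close>.\<close>

definition Dnk2 :: "nat \<Rightarrow> nat \<Rightarrow> diagram set" where
  "Dnk2 n k = {D. oplus_diagram k n D \<and>
     (\<forall>row \<in> set D. 2 \<le> length row \<and> hd row = Plus \<and> last row = Plus \<and>
        (\<forall>c. 0 < c \<and> c < length row - 1 \<longrightarrow> row ! c = Zero))}"

end

theory Submission
  imports Defs "Jordan_Normal_Form.DL_Rank" "HOL-Number_Theory.Cong"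
begin

text \<open>
  A linear relation between columns of a matrix is dual to a statement about its row space
  \<open>V\<close>: the column \<open>i\<close> lies in the span of the columns in \<open>C\<close> iff every \<open>w \<in> V\<close> vanishing on \<open>C\<close>
  vanishes at \<open>i\<close>. Hence the first returns depend only on \<open>V\<close>, and following the pipes of \<open>D\<close> shows
  that \<open>V\<close> has the decorated permutation of \<open>D\<close> iff the first return of \<open>n\<close> is \<open>s\<^sub>k + n\<close>, that of
  \<open>s\<^sub>j + 1\<close> is \<open>s\<^bsub>j-1\<^esub> + n\<close> (with \<open>s\<^sub>0 = 0\<close>), that of the first label of a run of consecutive vertical
  labels is the label just after the run, and all other columns vanish.

  Given a basis \<open>v\<close> as in the statement, these returns are read off by solving triangular systems
  for the coefficients of \<open>w \<in> V\<close>, and a maximal minor is nonnegative by expansion along column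
  \<open>n\<close>: in the remaining columns only the identity permutation contributes to a minor.

  Conversely, the columns \<open>s\<^sub>1, \<dots>, s\<^sub>k\<close> of \<open>V\<close> form a basis, and the dual basis vector of \<open>s\<^sub>j\<close> is
  supported on \<open>s\<^sub>j\<close>, the label \<open>h\<close> after the run of \<open>s\<^sub>j\<close>, and \<open>n\<close>. Signs come from the relation
  \<open>\<Sum>\<^sub>e \<plusminus> w\<^sub>e \<Delta>\<^bsub>J - e\<^esub> = 0\<close> for \<open>w \<in> V\<close> and \<open>|J| = k + 1\<close>. The entry at \<open>h\<close> never vanishes: if it did, the
  entry at \<open>n\<close> would get opposite signs from \<open>J = {s\<^sub>1, \<dots>, s\<^sub>k, n}\<close> and from the set obtained by
  exchanging the first label of the run for \<open>h\<close>. Then \<open>v i\<close> is the combination of two consecutive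
  dual basis vectors that vanishes at \<open>h\<close>.
\<close>

section \<open>Spans and first returns\<close>

lemma (in vec_space) span_insertI:
  assumes C: "C \<subseteq> carrier_vec n" and c: "c \<in> carrier_vec n" and x: "x \<in> carrier_vec n"
    and sp: "x - a \<cdot>\<^sub>v c \<in> span C"
  shows "x \<in> span (insert c C)"
proof -
  have ins: "insert c C \<subseteq> carrier_vec n" using C c by auto
  have "x - a \<cdot>\<^sub>v c \<in> span (insert c C)"
    using sp span_is_monotone[of C "insert c C"] by auto
  moreover have "a \<cdot>\<^sub>v c \<in> span (insert c C)"
    using ins by (intro smult_in_span span_mem) auto
  ultimately have "(x - a \<cdot>\<^sub>v c) + a \<cdot>\<^sub>v c \<in> span (insert c C)"
    by (intro span_add1[OF ins])
  moreover have "(x - a \<cdot>\<^sub>v c) + a \<cdot>\<^sub>v c = x" using x c by auto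
  ultimately show ?thesis by simp
qed

text \<open>A subspace is cut out by the functionals that kill it; induction on \<open>C\<close>. If
  everything orthogonal to \<open>C\<close> also kills \<open>c\<close>, the hypothesis on
  \<open>x\<close> already holds for \<open>C\<close>. Otherwise some \<open>z\<close> orthogonal to
  \<open>C\<close> with \<open>z \<bullet> c \<noteq> 0\<close> is used to remove the
  \<open>c\<close>-component of \<open>x\<close>.\<close>

lemma (in vec_space) in_span_if_orthogonal:
  assumes "finite C" "C \<subseteq> carrier_vec n" "x \<in> carrier_vec n"
    and "\<And>y. y \<in> carrier_vec n \<Longrightarrow> (\<And>c. c \<in> C \<Longrightarrow> y \<bullet> c = 0) \<Longrightarrow> y \<bullet> x = 0"
  shows "x \<in> span C"
  using assms
proof (induction C arbitrary: x rule: finite_induct)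
  case empty
  have "x = 0\<^sub>v n"
  proof (rule eq_vecI)
    fix i assume "i < dim_vec (0\<^sub>v n)"
    then show "x $ i = 0\<^sub>v n $ i"
      using empty.prems(2) empty.prems(3)[of "unit_vec n i"] by simp
  qed (use empty in auto)
  then show ?case by (simp add: span_empty)
next
  case (insert c C)
  then have c: "c \<in> carrier_vec n" and C: "C \<subseteq> carrier_vec n" and x: "x \<in> carrier_vec n" by auto
  show ?case
  proof (cases "\<forall>y\<in>carrier_vec n. (\<forall>c\<in>C. y \<bullet> c = 0) \<longrightarrow> y \<bullet> c = 0")
    case True
    have "x \<in> span C"
      using True insert.prems(3) by (intro insert.IH[OF C x]) auto
    then show ?thesis using span_is_monotone[of C "insert c C"] by auto
  next
    case False
    then obtain z where z: "z \<in> carrier_vec n" "\<And>c. c \<in> C \<Longrightarrow> z \<bullet> c = 0" "z \<bullet> c \<noteq> 0" by auto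
    \<comment> \<open>The coefficient for which \<open>x - a \<cdot>\<^sub>v c\<close> is killed by
      \<open>z\<close>.\<close>
    define a where "a = (z \<bullet> x) / (z \<bullet> c)"
    have "x - a \<cdot>\<^sub>v c \<in> span C"
    proof (rule insert.IH[OF C])
      show "x - a \<cdot>\<^sub>v c \<in> carrier_vec n" using x c by simp
      fix y assume y: "y \<in> carrier_vec n" "\<And>c. c \<in> C \<Longrightarrow> y \<bullet> c = 0"
      \<comment> \<open>Perhaps \<open>y\<close> does not kill \<open>c\<close>, but
        \<open>y - b \<cdot>\<^sub>v z\<close> does and is still orthogonal to \<open>C\<close>, so
        the hypothesis on \<open>x\<close> applies to it.\<close>
      define b where "b = (y \<bullet> c) / (z \<bullet> c)"
      have eq: "(y - b \<cdot>\<^sub>v z) \<bullet> u = y \<bullet> u - b * (z \<bullet> u)" if "u \<in> carrier_vec n" for u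
        using y(1) z(1) that by (simp add: minus_scalar_prod_distrib)
      have "(y - b \<cdot>\<^sub>v z) \<bullet> x = 0"
      proof (rule insert.prems(3))
        show "y - b \<cdot>\<^sub>v z \<in> carrier_vec n" using y z by simp
        fix u assume "u \<in> insert c C"
        then show "(y - b \<cdot>\<^sub>v z) \<bullet> u = 0"
          using eq[of u] y(2)[of u] z(2,3) C c by (auto simp: b_def)
      qed
      then have "y \<bullet> x = b * (z \<bullet> x)" using eq[OF x] by simp
      moreover have "y \<bullet> (x - a \<cdot>\<^sub>v c) = y \<bullet> x - a * (y \<bullet> c)"
        using y(1) x c by (simp add: scalar_prod_minus_distrib)
      ultimately show "y \<bullet> (x - a \<cdot>\<^sub>v c) = 0" using z(3) by (simp add: a_def b_def)
    qed
    then show ?thesis by (rule span_insertI[OF C c x])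
  qed
qed

lemma (in vec_space) in_span_iff_orthogonal:
  assumes "finite C" "C \<subseteq> carrier_vec n" "x \<in> carrier_vec n"
  shows "x \<in> span C \<longleftrightarrow> (\<forall>y\<in>carrier_vec n. (\<forall>c\<in>C. y \<bullet> c = 0) \<longrightarrow> y \<bullet> x = 0)"
proof
  assume "x \<in> span C"
  then obtain a A where A: "x = lincomb a A" "finite A" "A \<subseteq> C" using in_spanE by blast
  show "\<forall>y\<in>carrier_vec n. (\<forall>c\<in>C. y \<bullet> c = 0) \<longrightarrow> y \<bullet> x = 0"
  proof (intro ballI impI)
    fix y :: "'a vec" assume y: "y \<in> carrier_vec n" "\<forall>c\<in>C. y \<bullet> c = 0"
    have "y \<bullet> x = (\<Sum>i<n. y $ i * (\<Sum>u\<in>A. a u * u $ i))"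
      unfolding scalar_prod_def lessThan_atLeast0 A(1) lincomb_dim[OF A(2) subset_trans[OF A(3) assms(2)]]
      using A assms by (intro sum.cong) (auto simp: lincomb_index)
    also have "\<dots> = (\<Sum>u\<in>A. \<Sum>i<n. y $ i * (a u * u $ i))"
      unfolding sum_distrib_left by (rule sum.swap)
    also have "\<dots> = (\<Sum>u\<in>A. a u * (y \<bullet> u))"
      using A assms by (intro sum.cong) 
        (auto simp: scalar_prod_def lessThan_atLeast0 sum_distrib_left mult_ac intro!: sum.cong)
    also have "\<dots> = 0" using A y by (intro sum.neutral) auto
    finally show "y \<bullet> x = 0" .
  qed
qed (use in_span_if_orthogonal assms in auto)

section \<open>First returns read off the row space\<close>

abbreviation cyc :: "nat \<Rightarrow> real vec \<Rightarrow> nat \<Rightarrow> real" where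
  "cyc n w l \<equiv> w $ ((l - 1) mod n)"

text \<open>The dual form of column \<open>i\<close> lying in the span of the columns \<open>i + 1, \<dots>, j\<close>.\<close>

definition detects :: "nat \<Rightarrow> real vec set \<Rightarrow> nat \<Rightarrow> nat \<Rightarrow> bool" where
  "detects n V i j \<longleftrightarrow> (\<forall>w\<in>V. (\<forall>l\<in>{i<..j}. cyc n w l = 0) \<longrightarrow> cyc n w i = 0)"

definition return_index :: "nat \<Rightarrow> real vec set \<Rightarrow> nat \<Rightarrow> nat" where
  "return_index n V i = (LEAST j. i \<le> j \<and> detects n V i j)"

text \<open>A vector of the row space lists the values of one functional \<open>y\<close> on the
  columns. This turns the orthogonality criterion for spans into a statement about coordinates of
  members of \<open>V\<close>.\<close>

lemma represents_mem_iff: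
  assumes "represents k n A V"
  shows "w \<in> V \<longleftrightarrow> w \<in> carrier_vec n \<and> (\<exists>y\<in>carrier_vec k. \<forall>c<n. w $ c = y \<bullet> col A c)"
proof -
  have A: "A \<in> carrier_mat k n" and V: "V = vec_space.row_space n A"
    using assms by (auto simp: represents_def)
  have "A\<^sup>T *\<^sub>v y = w \<longleftrightarrow> (\<forall>c<n. w $ c = y \<bullet> col A c)"
    if "y \<in> carrier_vec k" "w \<in> carrier_vec n" for y
  proof -
    have "A\<^sup>T *\<^sub>v y = w \<longleftrightarrow> (\<forall>c<n. (A\<^sup>T *\<^sub>v y) $ c = w $ c)"
      using A that by (auto simp: vec_eq_iff)
    also have "\<dots> \<longleftrightarrow> (\<forall>c<n. w $ c = y \<bullet> col A c)"
      using A that by (auto simp: comm_scalar_prod[of _ k])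
    finally show ?thesis .
  qed
  then show ?thesis unfolding V vec_space.row_space_eq[OF A] using A by auto
qed

lemma represents_combination:
  assumes "represents k n A V" "u \<in> V" "w \<in> V"
  shows "a \<cdot>\<^sub>v u - b \<cdot>\<^sub>v w \<in> V"
proof -
  note mem = represents_mem_iff[OF assms(1)]
  have A: "A \<in> carrier_mat k n" using assms(1) by (simp add: represents_def)
  obtain y where y: "u \<in> carrier_vec n" "y \<in> carrier_vec k" "\<forall>c<n. u $ c = y \<bullet> col A c"
    using assms(2) mem by blast
  obtain z where z: "w \<in> carrier_vec n" "z \<in> carrier_vec k" "\<forall>c<n. w $ c = z \<bullet> col A c"
    using assms(3) mem by blast
  have "(a \<cdot>\<^sub>v u - b \<cdot>\<^sub>v w) $ c = (a \<cdot>\<^sub>v y - b \<cdot>\<^sub>v z) \<bullet> col A c" if "c < n" for c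
    using y z A that by (simp add: minus_scalar_prod_distrib[of _ k])
  then show ?thesis unfolding mem
    using y z by (intro conjI bexI[of _ "a \<cdot>\<^sub>v y - b \<cdot>\<^sub>v z"]) auto
qed

text \<open>By the orthogonality criterion both minima run over the same set. The right-hand side
  does not mention \<open>A\<close>, so the choice made by \<open>SOME\<close> in
  \<open>dperm_of\<close> cannot affect the first returns.\<close>

lemma first_return_eq_return_index:
  assumes "represents k n A V" and n: "n > 0"
  shows "first_return k n A i = return_index n V i"
proof -
  interpret vec_space "TYPE(real)" k .
  have A: "A \<in> carrier_mat k n" using assms by (auto simp: represents_def)
  have C: "cyc_col n A j \<in> carrier_vec k" for j using A n by (auto simp: cyc_col_def)
  have "cyc_col n A i \<in> span (cyc_col n A ` {i<..j}) \<longleftrightarrow> detects n V i j" for j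
  proof -
    have "cyc_col n A i \<in> span (cyc_col n A ` {i<..j}) \<longleftrightarrow>
        (\<forall>y\<in>carrier_vec k. (\<forall>l\<in>{i<..j}. y \<bullet> cyc_col n A l = 0) \<longrightarrow> y \<bullet> cyc_col n A i = 0)"
      using C by (subst in_span_iff_orthogonal) auto
    also have "\<dots> \<longleftrightarrow> detects n V i j"
    proof
      assume *: "\<forall>y\<in>carrier_vec k. (\<forall>l\<in>{i<..j}. y \<bullet> cyc_col n A l = 0) \<longrightarrow> y \<bullet> cyc_col n A i = 0"
      show "detects n V i j" unfolding detects_def
      proof (intro ballI impI)
        fix w assume "w \<in> V" and z: "\<forall>l\<in>{i<..j}. cyc n w l = 0"
        then obtain y where "y \<in> carrier_vec k" "\<forall>c<n. w $ c = y \<bullet> col A c"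
          using represents_mem_iff[OF assms(1)] by auto
        then show "cyc n w i = 0" using * z n by (auto simp: cyc_col_def)
      qed
    next
      assume *: "detects n V i j"
      show "\<forall>y\<in>carrier_vec k. (\<forall>l\<in>{i<..j}. y \<bullet> cyc_col n A l = 0) \<longrightarrow> y \<bullet> cyc_col n A i = 0"
      proof (intro ballI impI)
        fix y assume y: "y \<in> carrier_vec k" and z: "\<forall>l\<in>{i<..j}. y \<bullet> cyc_col n A l = 0"
        define w where "w = vec n (\<lambda>c. y \<bullet> col A c)"
        have "w \<in> V" using represents_mem_iff[OF assms(1), of w] y by (auto simp: w_def)
        moreover have "cyc n w l = y \<bullet> cyc_col n A l" for l
          using n by (simp add: w_def cyc_col_def)
        ultimately show "y \<bullet> cyc_col n A i = 0" using * z unfolding detects_def by metis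
      qed
    qed
    finally show ?thesis .
  qed
  then show ?thesis unfolding first_return_def return_index_def by simp
qed

lemma detects_mono: "detects n V i j \<Longrightarrow> j \<le> j' \<Longrightarrow> detects n V i j'"
  unfolding detects_def by (meson greaterThanAtMost_iff order_trans)

lemma cyc_wrap: "i \<ge> 1 \<Longrightarrow> cyc n w (i + n) = cyc n w i"
proof -
  assume "i \<ge> 1"
  then have "i + n - 1 = (i - 1) + n" by simp
  then show ?thesis by (simp only: mod_add_self2)
qed

lemma cyc_eq_coord: "i \<in> {1..n} \<Longrightarrow> cyc n w i = coord w i"
  by (subst mod_less) auto

lemma detects_full_turn: "n > 0 \<Longrightarrow> i \<ge> 1 \<Longrightarrow> detects n V i (i + n)"
  unfolding detects_def using cyc_wrap by (metis greaterThanAtMost_iff less_add_same_cancel1 order_refl)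

text \<open>Detection is monotone in the right end, so the minimum is pinned down by two tests, at
  \<open>m\<close> and at \<open>m - 1\<close>; for \<open>m = i\<close> only the first one
  remains.\<close>

lemma return_index_eq_iff:
  assumes "n > 0" "i \<ge> 1" "i \<le> m"
  shows "return_index n V i = m \<longleftrightarrow> detects n V i m \<and> (i < m \<longrightarrow> \<not> detects n V i (m - 1))"
proof
  have ex: "i \<le> i + n \<and> detects n V i (i + n)" using detects_full_turn assms by simp
  assume m: "return_index n V i = m"
  have "detects n V i m" using LeastI[of "\<lambda>j. i \<le> j \<and> detects n V i j", OF ex] m
    by (simp add: return_index_def)
  moreover have "\<not> detects n V i (m - 1)" if "i < m"
    using not_less_Least[of "m - 1" "\<lambda>j. i \<le> j \<and> detects n V i j"] m that
    by (simp add: return_index_def)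
  ultimately show "detects n V i m \<and> (i < m \<longrightarrow> \<not> detects n V i (m - 1))" by blast
next
  assume m: "detects n V i m \<and> (i < m \<longrightarrow> \<not> detects n V i (m - 1))"
  show "return_index n V i = m" unfolding return_index_def
  proof (rule Least_equality)
    fix y assume y: "i \<le> y \<and> detects n V i y"
    show "m \<le> y"
    proof (rule ccontr)
      assume "\<not> m \<le> y"
      then have "detects n V i (m - 1)" using y detects_mono[of n V i y "m - 1"] by simp
      then show False using m y \<open>\<not> m \<le> y\<close> by auto
    qed
  qed (use m assms in auto)
qed

lemma return_index_bounds:
  assumes "n > 0" "i \<ge> 1"
  shows "i \<le> return_index n V i" "return_index n V i \<le> i + n"
proof -
  have ex: "i \<le> i + n \<and> detects n V i (i + n)" using detects_full_turn assms by simp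
  show "i \<le> return_index n V i" using LeastI[of "\<lambda>j. i \<le> j \<and> detects n V i j", OF ex]
    by (simp add: return_index_def)
  show "return_index n V i \<le> i + n" unfolding return_index_def by (rule Least_le) (rule ex)
qed

section \<open>Maximal minors\<close>

text \<open>A permutation with nonzero product picks a nonzero entry in each row, so its columns
  increase weakly, hence strictly by injectivity. Then \<open>i \<le> p i\<close> for all
  \<open>i\<close>, which only the identity satisfies.\<close>

lemma permutation_eq_id_if_monotone_support:
  fixes M :: "'a :: idom mat"
  assumes mono: "\<And>r r' c c'. r < r' \<Longrightarrow> r' < m \<Longrightarrow> c < m \<Longrightarrow> c' < m \<Longrightarrow>
      M $$ (r, c) \<noteq> 0 \<Longrightarrow> M $$ (r', c') \<noteq> 0 \<Longrightarrow> c \<le> c'"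
    and p: "p permutes {0..<m}" and nz: "(\<Prod>i = 0..<m. M $$ (i, p i)) \<noteq> 0"
  shows "p = id"
proof -
  have nz': "M $$ (i, p i) \<noteq> 0" if "i < m" for i using nz that by auto
  have lt: "p i < m" if "i < m" for i using permutes_in_image[OF p, of i] that by auto
  have sm: "p r < p r'" if "r < r'" "r' < m" for r r'
  proof -
    have "p r \<le> p r'" using that by (intro mono[of r r'] nz' lt) auto
    moreover have "p r \<noteq> p r'" using that permutes_inj[OF p] by (auto dest: injD)
    ultimately show ?thesis by simp
  qed
  have "i \<le> p i" if "i < m" for i
    using that
  proof (induction i)
    case (Suc i)
    then show ?case using sm[of i "Suc i"] by simp
  qed simp
  then show ?thesis using permutes_natset_ge[OF p] by auto
qed

lemma det_monotone_support:
  fixes M :: "'a :: idom mat"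
  assumes M: "M \<in> carrier_mat m m"
    and mono: "\<And>r r' c c'. r < r' \<Longrightarrow> r' < m \<Longrightarrow> c < m \<Longrightarrow> c' < m \<Longrightarrow>
      M $$ (r, c) \<noteq> 0 \<Longrightarrow> M $$ (r', c') \<noteq> 0 \<Longrightarrow> c \<le> c'"
  shows "det M = (\<Prod>i<m. M $$ (i, i))"
proof -
  let ?P = "{p. p permutes {0..<m}}"
  have "det M = (\<Sum>p\<in>?P. signof p * (\<Prod>i = 0..<m. M $$ (i, p i)))" by (rule det_def'[OF M])
  also have "\<dots> = (\<Sum>p\<in>{id}. signof p * (\<Prod>i = 0..<m. M $$ (i, p i)))"
  proof (rule sum.mono_neutral_right)
    show "\<forall>p\<in>?P - {id}. signof p * (\<Prod>i = 0..<m. M $$ (i, p i)) = 0"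
      using permutation_eq_id_if_monotone_support[of m M, OF mono] by fastforce
  qed (auto simp: finite_permutations permutes_id)
  finally show ?thesis by (simp add: lessThan_atLeast0)
qed

section \<open>Increasing enumerations of column sets, and the minors on them\<close>

lemma card_less_pick:
  assumes "c < card J" "finite J"
  shows "card {a\<in>J. a < pick J c} = c"
  using assms card_pick_le by auto

text \<open>The \<open>c\<close>-th element of a set is the one with exactly \<open>c\<close>
  smaller members, and an increasing \<open>g\<close> preserves that count.\<close>

lemma pick_image_strict_mono:
  assumes g: "strict_mono_on {..<m} g" and c: "c < m"
  shows "pick (g ` {..<m}) c = (g c :: nat)"
proof -
  have lt: "g a < g c \<longleftrightarrow> a < c" if "a < m" for a
    using strict_mono_on_less[OF g] that c by auto
  have "{a \<in> g ` {..<m}. a < g c} = g ` {..<c}" using lt c by auto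
  moreover have "card (g ` {..<c}) = c"
    using strict_mono_on_imp_inj_on[OF g] c
    by (subst card_image) (auto elim: inj_on_subset)
  ultimately have "card {a \<in> g ` {..<m}. a < g c} = c" by simp
  then show ?thesis using pick_card_in_set[of "g c" "g ` {..<m}"] c by auto
qed

lemma pick_strict_mono: "finite J \<Longrightarrow> strict_mono_on {..<card J} (pick J)"
  by (auto intro!: strict_mono_onI pick_mono_le)

lemma pick_image: "finite J \<Longrightarrow> pick J ` {..<card J} = J"
proof -
  assume J: "finite J"
  have "inj_on (pick J) {..<card J}" by (rule strict_mono_on_imp_inj_on[OF pick_strict_mono[OF J]])
  then have "card (pick J ` {..<card J}) = card J" by (simp add: card_image)
  moreover have "pick J ` {..<card J} \<subseteq> J" using J by (auto intro: pick_in_set_le)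
  ultimately show ?thesis using J by (simp add: card_subset_eq)
qed

lemma ex_pick:
  assumes "finite J" "c \<in> J"
  shows "\<exists>j<card J. c = pick J j"
proof -
  have "c \<in> pick J ` {..<card J}" using pick_image[OF assms(1)] assms(2) by simp
  then show ?thesis by blast
qed

text \<open>The shift past \<open>j\<close> is the one made by \<open>mat_delete\<close>, so a
  cofactor of a matrix of chosen columns is again a minor on chosen columns.\<close>

lemma pick_Diff:
  assumes J: "finite J" "card J = Suc m" and j: "j < Suc m" and c: "c < m"
  shows "pick (J - {pick J j}) c = pick J (if c < j then c else Suc c)"
proof -
  let ?g = "\<lambda>c. pick J (if c < j then c else Suc c)"
  have sm: "strict_mono_on {..<Suc m} (pick J)" using pick_strict_mono[of J] J by simp
  have "strict_mono_on {..<m} ?g"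
    using sm by (auto intro!: strict_mono_onI strict_mono_onD[OF sm])
  moreover have "?g ` {..<m} = J - {pick J j}"
  proof -
    have "(\<lambda>c. if c < j then c else Suc c) ` {..<m} = {..<Suc m} - {j}"
    proof (intro equalityI subsetI)
      fix x assume "x \<in> {..<Suc m} - {j}"
      then show "x \<in> (\<lambda>c. if c < j then c else Suc c) ` {..<m}"
        using j by (intro image_eqI[of _ _ "if x < j then x else x - 1"]) auto
    qed auto
    then have "?g ` {..<m} = pick J ` ({..<Suc m} - {j})"
      by (metis (no_types) image_image)
    also have "\<dots> = pick J ` {..<Suc m} - {pick J j}"
      using strict_mono_on_imp_inj_on[OF sm] j by (subst inj_on_image_set_diff) auto
    finally show ?thesis using pick_image[OF J(1)] J(2) by simp
  qed
  ultimately show ?thesis using pick_image_strict_mono[of m ?g c] c by simp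
qed

lemma submatrix_UNIV_eq:
  assumes "A \<in> carrier_mat k n" "J \<subseteq> {..<n}"
  shows "submatrix A UNIV J = mat k (card J) (\<lambda>(i, j). A $$ (i, pick J j))"
proof -
  have "{j. j < n \<and> j \<in> J} = J" using assms by auto
  then show ?thesis using assms by (auto simp: submatrix_def pick_UNIV)
qed

lemma pick_lt: "J \<subseteq> {..<n} \<Longrightarrow> c < card J \<Longrightarrow> pick J c < n"
  using pick_in_set_le by blast

text \<open>Appending a row of the row space on top of the \<open>k + 1\<close> chosen columns gives a singular
  matrix; this is its expansion along the new row.\<close>

lemma row_space_circuit_relation:
  fixes A :: "'a :: field mat"
  assumes A: "A \<in> carrier_mat k n" and J: "J \<subseteq> {..<n}" "card J = Suc k"
    and y: "y \<in> carrier_vec k" and w: "\<And>c. c < n \<Longrightarrow> w $ c = y \<bullet> col A c"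
  shows "(\<Sum>e\<in>J. (-1) ^ card {a\<in>J. a < e} * w $ e * det (submatrix A UNIV (J - {e}))) = 0"
proof -
  have fin: "finite J" using J finite_subset by blast
  define M where "M = mat (Suc k) (Suc k)
    (\<lambda>(i, j). if i = 0 then w $ pick J j else A $$ (i - 1, pick J j))"
  have M: "M \<in> carrier_mat (Suc k) (Suc k)" by (simp add: M_def)
  have lt: "pick J j < n" if "j < Suc k" for j using pick_lt[OF J(1)] J(2) that by simp
  \<comment> \<open>The new row is the combination \<open>y\<close> of the rows of \<open>A\<close>;
    \<open>z\<close> records this relation among the rows of \<open>M\<close>. Its entry
    \<open>-1\<close> at the new row keeps it nonzero even when \<open>y\<close> is zero.\<close>
  define z where "z = vec (Suc k) (\<lambda>i. if i = 0 then - 1 else y $ (i - 1))"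
  have "M\<^sup>T *\<^sub>v z = 0\<^sub>v (Suc k)"
  proof (rule eq_vecI)
    fix j assume "j < dim_vec (0\<^sub>v (Suc k) :: 'a vec)"
    then have j: "j < Suc k" by simp
    have "(M\<^sup>T *\<^sub>v z) $ j = (\<Sum>i<Suc k. M $$ (i, j) * z $ i)"
      using j M by (simp add: scalar_prod_def lessThan_atLeast0 z_def)
    also have "\<dots> = - w $ pick J j + (\<Sum>i<k. A $$ (i, pick J j) * y $ i)"
      using j by (subst sum.lessThan_Suc_shift) (simp add: M_def z_def)
    also have "(\<Sum>i<k. A $$ (i, pick J j) * y $ i) = w $ pick J j"
      using w[OF lt[OF j]] A lt[OF j] y by (simp add: scalar_prod_def lessThan_atLeast0 mult.commute)
    finally show "(M\<^sup>T *\<^sub>v z) $ j = 0\<^sub>v (Suc k) $ j" using j by simp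
  qed (use M in auto)
  moreover have "z $ 0 = - 1" "z \<in> carrier_vec (Suc k)" by (auto simp: z_def)
  moreover from this have "z \<noteq> 0\<^sub>v (Suc k)" by auto
  ultimately have "det (M\<^sup>T) = 0"
    using det_0_iff_vec_prod_zero_field[of "M\<^sup>T" "Suc k"] M by auto
  then have "0 = det M" using det_transpose[OF M] by simp
  also have "\<dots> = (\<Sum>j<Suc k. M $$ (0, j) * cofactor M 0 j)"
    by (rule laplace_expansion_row[OF M]) simp
  also have "\<dots> = (\<Sum>j<Suc k. (-1) ^ j * w $ pick J j * det (submatrix A UNIV (J - {pick J j})))"
  proof (rule sum.cong[OF refl])
    fix j assume "j \<in> {..<Suc k}"
    then have j: "j < Suc k" by simp
    have "pick J j \<in> J" using pick_in_set_le[of j J] j J by simp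
    then have cd: "card (J - {pick J j}) = k" using J fin by simp
    have "mat_delete M 0 j = submatrix A UNIV (J - {pick J j})"
    proof (subst submatrix_UNIV_eq[OF A])
      show "J - {pick J j} \<subseteq> {..<n}" using J by auto
      show "mat_delete M 0 j = mat k (card (J - {pick J j})) (\<lambda>(i, ja). A $$ (i, pick (J - {pick J j}) ja))"
        unfolding cd
        by (rule eq_matI) (use j J fin in \<open>auto simp: M_def mat_delete_def pick_Diff\<close>)
    qed
    then show "M $$ (0, j) * cofactor M 0 j =
        (-1) ^ j * w $ pick J j * det (submatrix A UNIV (J - {pick J j}))"
      using j by (simp add: cofactor_def M_def)
  qed
  also have "\<dots> = (\<Sum>e\<in>pick J ` {..<Suc k}.
      (-1) ^ card {a\<in>J. a < e} * w $ e * det (submatrix A UNIV (J - {e})))"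
    using strict_mono_on_imp_inj_on[OF pick_strict_mono[OF fin]] J fin
    by (subst sum.reindex) (auto simp: card_less_pick intro!: sum.cong)
  finally show ?thesis using pick_image[OF fin] J by simp
qed

text \<open>A zero minor would put a nonzero \<open>y\<close> into the kernel of the transposed
  submatrix, and such a \<open>y\<close> kills every column in \<open>T\<close>.\<close>

lemma minor_nonzero_if_separating:
  fixes A :: "'a :: field mat"
  assumes A: "A \<in> carrier_mat k n" and T: "T \<subseteq> {..<n}" "card T = k"
    and sep: "\<And>y. y \<in> carrier_vec k \<Longrightarrow> (\<And>c. c \<in> T \<Longrightarrow> y \<bullet> col A c = 0) \<Longrightarrow> y = 0\<^sub>v k"
  shows "det (submatrix A UNIV T) \<noteq> 0"
proof
  let ?M = "submatrix A UNIV T"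
  have fin: "finite T" using T finite_subset by blast
  have Meq: "?M = mat k k (\<lambda>(i, j). A $$ (i, pick T j))" using submatrix_UNIV_eq[OF A T(1)] T(2) by simp
  then have M: "?M \<in> carrier_mat k k" by simp
  assume "det ?M = 0"
  then have "det (?M\<^sup>T) = 0" using det_transpose[OF M] by simp
  then obtain y where y: "y \<in> carrier_vec k" "y \<noteq> 0\<^sub>v k" "?M\<^sup>T *\<^sub>v y = 0\<^sub>v k"
    using det_0_iff_vec_prod_zero_field[of "?M\<^sup>T" k] M by auto
  have "y \<bullet> col A c = 0" if cT: "c \<in> T" for c
  proof -
    obtain j where j: "j < k" "c = pick T j"
      using ex_pick[OF fin cT] T(2) by auto
    have "c < n" using cT T by auto
    have "y \<bullet> col A c = (?M\<^sup>T *\<^sub>v y) $ j"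
      using j y(1) A M \<open>c < n\<close> by (auto simp: Meq scalar_prod_def intro!: sum.cong)
    then show ?thesis using y(3) j by simp
  qed
  then show False using sep y by blast
qed

text \<open>\<open>y\<close> is a row of the inverse of the submatrix, written as adjugate divided
  by determinant; its products with the chosen columns are entries of the identity matrix.\<close>

lemma dual_basis_on_columns:
  fixes A :: "'a :: field mat"
  assumes A: "A \<in> carrier_mat k n" and T: "T \<subseteq> {..<n}" "card T = k"
    and nz: "det (submatrix A UNIV T) \<noteq> 0" and p: "p \<in> T"
  obtains y where "y \<in> carrier_vec k" "\<And>c. c \<in> T \<Longrightarrow> y \<bullet> col A c = (if c = p then 1 else 0)"
proof -
  let ?M = "submatrix A UNIV T"
  have fin: "finite T" using T finite_subset by blast
  have Meq: "?M = mat k k (\<lambda>(i, j). A $$ (i, pick T j))" using submatrix_UNIV_eq[OF A T(1)] T(2) by simp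
  then have M: "?M \<in> carrier_mat k k" by simp
  note adj = adj_mat[OF M]
  have pk: "\<exists>j<k. c = pick T j" if "c \<in> T" for c
    using ex_pick[OF fin that] T(2) by auto
  obtain q where q: "q < k" "p = pick T q" using pk p by blast
  define y where "y = (1 / det ?M) \<cdot>\<^sub>v row (adj_mat ?M) q"
  show thesis
  proof
    show "y \<in> carrier_vec k" using adj(1) row_carrier[of "adj_mat ?M" q] by (simp add: y_def)
    fix c assume c: "c \<in> T"
    then obtain j where j: "j < k" "c = pick T j" using pk by blast
    have "c < n" using c T by auto
    have "col A c = col ?M j" using A M j \<open>c < n\<close> by (intro eq_vecI) (auto simp: Meq)
    then have "y \<bullet> col A c = (1 / det ?M) * ((adj_mat ?M * ?M) $$ (q, j))"
      using adj(1) M j q by (simp add: y_def)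
    also have "\<dots> = (if j = q then 1 else 0)" using nz j q by (simp add: adj(3))
    also have "(j = q) = (c = p)"
      using strict_mono_on_imp_inj_on[OF pick_strict_mono[OF fin]] j q T(2) by (auto simp: inj_on_def)
    finally show "y \<bullet> col A c = (if c = p then 1 else 0)" .
  qed
qed

text \<open>At most \<open>k\<close> rows span a space of dimension \<open>k\<close>, so they are
  independent. Their distinctness is part of the argument, since \<open>set (rows A)\<close> would
  hide a repeated row.\<close>

lemma represents_rows_independent:
  assumes "represents k n A V" and dim: "vectorspace.dim class_ring (subspace_vs n V) = k"
    and y: "y \<in> carrier_vec k" and z: "\<And>c. c < n \<Longrightarrow> y \<bullet> col A c = 0"
  shows "y = 0\<^sub>v k"
proof (rule ccontr)
  assume nz: "y \<noteq> 0\<^sub>v k"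
  interpret vec_space "TYPE(real)" n .
  have A: "A \<in> carrier_mat k n" and V: "V = span (set (rows A))"
    using assms by (auto simp: represents_def row_space_def)
  have R: "set (rows A) \<subseteq> carrier_vec n" using A rows_carrier by blast
  have vsV: "vectorspace class_ring (span_vs (set (rows A)))"
    using vector_space_row_space[OF A] by (simp add: row_space_def)
  interpret W: vectorspace class_ring "span_vs (set (rows A))" by (rule vsV)
  have sub: "set (rows A) \<subseteq> span (set (rows A))" using in_own_span R by blast
  have "W.span (set (rows A)) = span (set (rows A))"
    using span_li_not_depend(1)[OF sub span_is_submodule] R by simp
  then have "W.dim \<le> card (set (rows A))" using sub by (intro W.gen_ge_dim) auto
  moreover have Wd: "W.dim = k" using dim V by simp
  moreover have "card (set (rows A)) \<le> k" using card_length[of "rows A"] A by simp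
  ultimately have card: "card (set (rows A)) = k" by simp
  then have "distinct (rows A)" using A by (intro card_distinct) auto
  then have "distinct (cols A\<^sup>T)" using A by simp
  moreover have "lin_indpt (set (rows A))"
    using full_dim_span[OF _ _ Wd[folded card]] R by simp
  moreover have "A\<^sup>T *\<^sub>v y = 0\<^sub>v n"
    using z A y by (intro eq_vecI) (auto simp: comm_scalar_prod[of _ k])
  ultimately show False
    using lin_depI[of "A\<^sup>T" k y] A y nz by auto
qed

section \<open>Labels along the lattice path\<close>

lemma length_border:
  "sorted_wrt (\<ge>) ls \<Longrightarrow> \<forall>l\<in>set ls. l \<le> w \<Longrightarrow> length (border r w ls) = w + length ls"
  by (induction ls arbitrary: r w) auto

lemma set_border:
  "sorted_wrt (\<ge>) ls \<Longrightarrow> \<forall>l\<in>set ls. l \<le> w \<Longrightarrow>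
   set (border r w ls) = Vert ` {r..<r + length ls} \<union> Horiz ` {..<w}"
proof (induction ls arbitrary: r w)
  case (Cons l ls)
  have "set (border r w (l # ls)) =
      Horiz ` {l..<w} \<union> {Vert r} \<union> (Vert ` {Suc r..<Suc r + length ls} \<union> Horiz ` {..<l})"
    using Cons by auto
  also have "\<dots> = Vert ` insert r {Suc r..<Suc r + length ls} \<union> Horiz ` ({l..<w} \<union> {..<l})" by auto
  also have "insert r {Suc r..<Suc r + length ls} = {r..<r + length (l # ls)}" by auto
  also have "{l..<w} \<union> {..<l} = {..<w}" using Cons by auto
  finally show ?case .
qed auto

lemma distinct_border:
  "sorted_wrt (\<ge>) ls \<Longrightarrow> \<forall>l\<in>set ls. l \<le> w \<Longrightarrow> distinct (border r w ls)"
proof (induction ls arbitrary: r w)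
  case (Cons l ls)
  then show ?case
    using set_border[of ls l "Suc r"] by (auto simp: distinct_map inj_on_def)
qed (auto simp: distinct_map inj_on_def)

text \<open>Before the vertical step of row \<open>q\<close> the path has made
  \<open>w - ls ! q\<close> horizontal and \<open>q\<close> vertical steps.\<close>

lemma border_nth_Vert:
  "sorted_wrt (\<ge>) ls \<Longrightarrow> \<forall>l\<in>set ls. l \<le> w \<Longrightarrow> q < length ls \<Longrightarrow>
   border r w ls ! (w - ls ! q + q) = Vert (r + q)"
proof (induction ls arbitrary: r w q)
  case (Cons l ls)
  show ?case
  proof (cases q)
    case (Suc q')
    then have "ls ! q' \<le> l" "l \<le> w" using Cons.prems by auto
    then have eq: "w - (l # ls) ! q + q = length (map Horiz (rev [l..<w])) + Suc (l - ls ! q' + q')"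
      using Suc by simp
    have "border (Suc r) l ls ! (l - ls ! q' + q') = Vert (Suc r + q')"
      using Cons.prems Suc by (intro Cons.IH) auto
    then show ?thesis unfolding eq border.simps nth_append_length_plus using Suc by simp
  qed (simp add: nth_append)
qed auto

text \<open>Before the horizontal step below column \<open>c\<close> come the
  \<open>w - 1 - c\<close> columns to its right and the vertical steps of exactly the rows that
  contain column \<open>c\<close>.\<close>

lemma border_nth_Horiz:
  "sorted_wrt (\<ge>) ls \<Longrightarrow> \<forall>l\<in>set ls. l \<le> w \<Longrightarrow> c < w \<Longrightarrow>
   border r w ls ! (w - 1 - c + card {q. q < length ls \<and> c < ls ! q}) = Horiz c"
proof (induction ls arbitrary: r w)
  case Nil
  then show ?case by (simp add: rev_nth)
next
  case (Cons l ls)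
  show ?case
  proof (cases "c < l")
    case True
    have "{q. q < length (l # ls) \<and> c < (l # ls) ! q} =
        insert 0 (Suc ` {q. q < length ls \<and> c < ls ! q})"
      using True by (auto simp: image_iff less_Suc_eq_0_disj)
    then have "card {q. q < length (l # ls) \<and> c < (l # ls) ! q} =
        Suc (card {q. q < length ls \<and> c < ls ! q})"
      by (simp add: card_image)
    then have eq: "w - 1 - c + card {q. q < length (l # ls) \<and> c < (l # ls) ! q} =
        length (map Horiz (rev [l..<w])) + Suc (l - 1 - c + card {q. q < length ls \<and> c < ls ! q})"
      using True Cons.prems by simp
    have "border (Suc r) l ls ! (l - 1 - c + card {q. q < length ls \<and> c < ls ! q}) = Horiz c"
      using Cons.prems True by (intro Cons.IH) auto
    then show ?thesis unfolding eq border.simps nth_append_length_plus by simp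
  next
    case False
    have none: "{q. q < length (l # ls) \<and> c < (l # ls) ! q} = {}"
      using False Cons.prems by (fastforce simp: nth_Cons split: nat.splits dest: nth_mem)
    moreover have "w - 1 - c < w - l" using False Cons.prems by auto
    ultimately show ?thesis unfolding none using Cons.prems False by (simp add: nth_append rev_nth)
  qed
qed

section \<open>Vertical labels, their runs and the expected returns\<close>

locale staircase =
  fixes n k :: nat and s :: "nat \<Rightarrow> nat"
  assumes n_pos: "0 < n"
    and s_0: "s 0 = 0"
    and s_strict_mono: "strict_mono_on {0..k} s"
    and s_Suc_less: "i \<in> {1..k} \<Longrightarrow> s i + 1 < n"
begin

abbreviation S :: "nat set" where "S \<equiv> s ` {1..k}"

lemma s_less_iff: "i \<le> k \<Longrightarrow> j \<le> k \<Longrightarrow> s i < s j \<longleftrightarrow> i < j"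
  using strict_mono_on_less[OF s_strict_mono, of i j] by simp

lemma s_eq_iff: "i \<le> k \<Longrightarrow> j \<le> k \<Longrightarrow> s i = s j \<longleftrightarrow> i = j"
  using strict_mono_on_eq[OF s_strict_mono, of i j] by simp

lemma s_pos: "1 \<le> i \<Longrightarrow> i \<le> k \<Longrightarrow> 1 \<le> s i"
  using s_less_iff[of 0 i] s_0 by simp

lemma s_k_less: "s k < n"
  using s_Suc_less[of k] s_0 n_pos by (cases "k = 0") auto

text \<open>The first return of each label for the members of the cell, before reduction modulo \<open>n\<close>;
  the convention \<open>s 0 = 0\<close> lets \<open>n\<close> play the role of a zeroth label.\<close>

definition target :: "nat \<Rightarrow> nat" where
  "target i = (if i = n then s k + n
     else if i - 1 \<in> S then s (the_inv_into {1..k} s (i - 1) - 1) + n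
     else if i \<in> S then LEAST h. i < h \<and> h \<notin> S
     else i)"

lemma target_n: "target n = s k + n" by (simp add: target_def)

lemma target_Suc:
  assumes "j \<in> {1..k}" shows "target (s j + 1) = s (j - 1) + n"
proof -
  have "inj_on s {1..k}" using s_eq_iff by (auto simp: inj_on_def)
  then have "the_inv_into {1..k} s (s j) = j" using assms by (simp add: the_inv_into_f_f)
  then show ?thesis using s_Suc_less[OF assms] assms by (simp add: target_def)
qed

lemma target_run_start:
  assumes "j \<in> {1..k}" "s j - 1 \<notin> S"
    and "s j < h" "h \<notin> S" "\<And>l. s j \<le> l \<Longrightarrow> l < h \<Longrightarrow> l \<in> S"
  shows "target (s j) = h"
proof -
  have "(LEAST h. s j < h \<and> h \<notin> S) = h"
    using assms by (intro Least_equality) (auto simp: not_less[symmetric])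
  then show ?thesis using assms s_Suc_less[of j] by (simp add: target_def)
qed

lemma target_other:
  assumes "i \<noteq> n" "i - 1 \<notin> S" "i \<notin> S" shows "target i = i"
  using assms by (simp add: target_def)

text \<open>A run is a maximal block of consecutive labels in \<open>S\<close>. Its first label
  belongs to \<open>start\<close>; its other members, and the label just behind it, belong to
  \<open>after\<close>.\<close>

lemma index_cases:
  assumes "i \<in> {1..n}"
  obtains (last) "i = n" 
    | (after) j where "j \<in> {1..k}" "i = s j + 1"
    | (start) j where "j \<in> {1..k}" "i = s j" "s j - 1 \<notin> S"
    | (other) "i \<noteq> n" "i - 1 \<notin> S" "i \<notin> S"
proof -
  have "\<exists>j\<in>{1..k}. i = s j + 1" if iS: "i - 1 \<in> S"
  proof -
    obtain j where "j \<in> {1..k}" "i - 1 = s j" using iS by (rule imageE)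
    then show ?thesis using assms by (intro bexI[of _ j]) auto
  qed
  then show thesis using last after start other by blast
qed

text \<open>Runs are described by indices rather than labels. The search for the end stops at
  \<open>k\<close> at the latest, the label \<open>s k + 1\<close> being beyond all of
  \<open>S\<close>.\<close>

lemma run_end_exists:
  assumes "j \<in> {1..k}"
  obtains b where "j \<le> b" "b \<le> k" "s b + 1 \<notin> S" "\<And>l. j \<le> l \<Longrightarrow> l < b \<Longrightarrow> s (Suc l) = s l + 1"
proof -
  define b where "b = (LEAST b. j \<le> b \<and> s b + 1 \<notin> S)"
  have k: "j \<le> k \<and> s k + 1 \<notin> S"
  proof -
    have "s i \<noteq> s k + 1" if "i \<in> {1..k}" for i using s_less_iff[of k i] that by auto
    then have "s k + 1 \<notin> S" by (metis imageE)
    then show ?thesis using assms by auto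
  qed
  have b: "j \<le> b \<and> s b + 1 \<notin> S" unfolding b_def by (rule LeastI) (rule k)
  have bk: "b \<le> k" unfolding b_def by (rule Least_le) (rule k)
  have "s (Suc l) = s l + 1" if l: "j \<le> l" "l < b" for l
  proof -
    \<comment> \<open>Minimality of \<open>b\<close> puts \<open>s l + 1\<close> into
      \<open>S\<close>; by strict growth no index other than \<open>Suc l\<close> can carry
      it.\<close>
    have "s l + 1 \<in> S" using not_less_Least[of l "\<lambda>b. j \<le> b \<and> s b + 1 \<notin> S"] l by (auto simp: b_def)
    then obtain i where i: "i \<in> {1..k}" "s i = s l + 1" by auto
    have "l < i" using s_less_iff[of l i] i l bk by auto
    moreover have "\<not> Suc l < i"
    proof
      assume "Suc l < i"
      then have "s l < s (Suc l)" "s (Suc l) < s i"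
        using s_less_iff[of l "Suc l"] s_less_iff[of "Suc l" i] i(1) l bk by auto
      then show False using i by simp
    qed
    ultimately have "i = Suc l" by simp
    then show ?thesis using i by simp
  qed
  then show thesis using that b bk by blast
qed

lemma s_run: 
  assumes "\<And>l. j \<le> l \<Longrightarrow> l < b \<Longrightarrow> s (Suc l) = s l + 1"
  shows "j \<le> i \<Longrightarrow> i \<le> b \<Longrightarrow> s i = s j + (i - j)"
proof (induction "i - j" arbitrary: i)
  case (Suc d)
  then have "s (i - 1) = s j + (i - 1 - j)" by (intro Suc.hyps(1)) auto
  moreover have "s i = s (i - 1) + 1" using assms[of "i - 1"] Suc by simp
  ultimately show ?case using Suc by simp
qed auto

lemma target_run:
  assumes "j \<in> {1..k}" "s j - 1 \<notin> S" "j \<le> b" "b \<le> k" "s b + 1 \<notin> S"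
    and run: "\<And>l. j \<le> l \<Longrightarrow> l < b \<Longrightarrow> s (Suc l) = s l + 1"
  shows "target (s j) = s b + 1"
proof (rule target_run_start[OF assms(1,2)])
  have r: "s i = s j + (i - j)" if "j \<le> i" "i \<le> b" for i
    using s_run[of j b i] run that by blast
  show "s j < s b + 1" using s_less_iff[of b j] assms by (meson le_less_trans less_add_one not_less order_le_less_trans atLeastAtMost_iff)
  show "s b + 1 \<notin> S" by fact
  fix l assume l: "s j \<le> l" "l < s b + 1"
  have "s b = s j + (b - j)" using r[of b] assms by simp
  then have "j + (l - s j) \<le> b" using l assms by linarith
  moreover from this have "l = s (j + (l - s j))" using l r[of "j + (l - s j)"] by simp
  ultimately show "l \<in> S" using assms by (intro image_eqI[of _ _ "j + (l - s j)"]) auto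
qed

text \<open>The strict upper bound excludes white fixed points and places the target in a window of
  \<open>n\<close> numbers, on which residues are faithful.\<close>

lemma target_bounds:
  assumes "i \<in> {1..n}"
  shows "i \<le> target i" "target i < i + n"
proof -
  have "i \<le> target i \<and> target i < i + n" using assms
  proof (cases rule: index_cases)
    case last
    then show ?thesis using s_k_less by (simp add: target_n)
  next
    case (after j)
    then have "s (j - 1) < s j" using s_less_iff[of "j - 1" j] by auto
    then show ?thesis using target_Suc[OF after(1)] after s_Suc_less[OF after(1)] by simp
  next
    case (start j)
    obtain b where b: "j \<le> b" "b \<le> k" "s b + 1 \<notin> S" "\<And>l. j \<le> l \<Longrightarrow> l < b \<Longrightarrow> s (Suc l) = s l + 1"
      using run_end_exists[OF start(1)] by blast
    have "s j \<le> s b" using s_less_iff[of b j] b start by (auto simp: not_less[symmetric])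
    then show ?thesis using target_run[OF start(1,3) b] start b s_Suc_less[of b] by simp
  next
    case other
    then show ?thesis using n_pos by (simp add: target_other)
  qed
  then show "i \<le> target i" "target i < i + n" by auto
qed

end

section \<open>Pipes\<close>

lemma pipe_north_straight:
  "(\<And>r'. r' < r \<Longrightarrow> D ! r' ! c = Zero) \<Longrightarrow> pipe_north D r c = Horiz c"
  by (induction r) auto

section \<open>Edges, labels and pipes of a diagram from \<open>Dnk2\<close>\<close>

locale two_plus_diagram =
  fixes n k :: nat and D :: diagram
  assumes D: "D \<in> Dnk2 n k" and n_pos: "0 < n"
begin

abbreviation lam :: "nat \<Rightarrow> nat" where "lam r \<equiv> length (D ! r)"

lemma D_shape:
  shows k_le: "k \<le> n" and length_D: "length D = k"
    and D_sorted: "sorted_wrt (\<ge>) (map length D)"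
    and lam_le: "r < k \<Longrightarrow> lam r \<le> n - k"
    and lam_ge: "r < k \<Longrightarrow> 2 \<le> lam r"
    and lam_antimono: "r \<le> r' \<Longrightarrow> r' < k \<Longrightarrow> lam r' \<le> lam r"
    and D_first: "r < k \<Longrightarrow> D ! r ! 0 = Plus"
    and D_last: "r < k \<Longrightarrow> D ! r ! (lam r - 1) = Plus"
    and D_mid: "r < k \<Longrightarrow> 0 < c \<Longrightarrow> c < lam r - 1 \<Longrightarrow> D ! r ! c = Zero"
proof -
  have O: "oplus_diagram k n D" and R: "\<And>row. row \<in> set D \<Longrightarrow> 2 \<le> length row \<and> hd row = Plus \<and>
      last row = Plus \<and> (\<forall>c. 0 < c \<and> c < length row - 1 \<longrightarrow> row ! c = Zero)"
    using D by (auto simp: Dnk2_def)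
  show "k \<le> n" "length D = k" and "sorted_wrt (\<ge>) (map length D)"
    using O by (auto simp: oplus_diagram_def)
  then show "lam r' \<le> lam r" if "r \<le> r'" "r' < k"
    using that by (cases "r = r'") (auto simp: sorted_wrt_map sorted_wrt_iff_nth_less)
  show "r < k \<Longrightarrow> lam r \<le> n - k" using O by (auto simp: oplus_diagram_def)
  assume r: "r < k"
  then have Dr: "D ! r \<in> set D" using O by (auto simp: oplus_diagram_def)
  note R = R[OF Dr]
  show "2 \<le> lam r" using R by simp
  have "D ! r \<noteq> []" using R by auto
  then show "D ! r ! 0 = Plus" "D ! r ! (lam r - 1) = Plus"
    using R hd_conv_nth last_conv_nth by metis+
  show "0 < c \<Longrightarrow> c < lam r - 1 \<Longrightarrow> D ! r ! c = Zero" using R by simp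
qed

text \<open>Labels are places on the lattice path: the step of row \<open>r\<close> comes after
  \<open>n - k - lam r\<close> horizontal and \<open>r\<close> vertical ones.\<close>

definition row_label :: "nat \<Rightarrow> nat" where
  "row_label r = n - k - lam r + r + 1"

text \<open>Counts the columns from \<open>c\<close> to the right edge and the rows containing
  column \<open>c\<close>: all steps up to and including the one below column
  \<open>c\<close>.\<close>

definition col_label :: "nat \<Rightarrow> nat" where
  "col_label c = n - k - c + card {r. r < k \<and> c < lam r}"

lemma lengths_le: "\<forall>l\<in>set (map length D). l \<le> n - k"
  using lam_le length_D by (auto simp: in_set_conv_nth)

lemma length_se_border: "length (se_border k n D) = n"
  using length_border[OF D_sorted lengths_le] k_le length_D by (simp add: se_border_def)

lemma set_se_border: "set (se_border k n D) = Vert ` {..<k} \<union> Horiz ` {..<n - k}"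
  using set_border[OF D_sorted lengths_le, of 0] length_D by (auto simp: se_border_def)

lemma distinct_se_border: "distinct (se_border k n D)"
  using distinct_border[OF D_sorted lengths_le] by (simp add: se_border_def)

lemma edge_at_row_label: "r < k \<Longrightarrow> edge_at k n D (row_label r) = Vert r"
  using border_nth_Vert[OF D_sorted lengths_le, of r 0] length_D
  by (simp add: edge_at_def se_border_def row_label_def)

lemma row_label_range: "r < k \<Longrightarrow> row_label r \<in> {1..n}"
  using lam_ge[of r] lam_le[of r] by (auto simp: row_label_def)

lemma card_rows_le: "card {r. r < k \<and> c < lam r} \<le> k"
  using card_mono[of "{..<k}" "{r. r < k \<and> c < lam r}"] by auto

lemma col_label_range: "c < n - k \<Longrightarrow> col_label c \<in> {1..n}"
  using card_rows_le[of c] by (auto simp: col_label_def)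

lemma edge_at_col_label:
  assumes "c < n - k" shows "edge_at k n D (col_label c) = Horiz c"
proof -
  have "{q. q < length (map length D) \<and> c < map length D ! q} = {r. r < k \<and> c < lam r}"
    using length_D by auto
  then show ?thesis
    using border_nth_Horiz[OF D_sorted lengths_le assms, of 0] assms
    by (simp add: edge_at_def se_border_def col_label_def)
qed

lemma edge_at_inj: "i \<in> {1..n} \<Longrightarrow> j \<in> {1..n} \<Longrightarrow> edge_at k n D i = edge_at k n D j \<longleftrightarrow> i = j"
  using nth_eq_iff_index_eq[OF distinct_se_border, of "i - 1" "j - 1"] length_se_border
  by (auto simp: edge_at_def) linarith

lemma label_of_edge_at: "i \<in> {1..n} \<Longrightarrow> label_of k n D (edge_at k n D i) = i"
  unfolding label_of_def using edge_at_inj by (intro the_equality) auto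

lemma label_of_Vert: "r < k \<Longrightarrow> label_of k n D (Vert r) = row_label r"
  using label_of_edge_at[OF row_label_range] edge_at_row_label by simp

lemma label_of_Horiz: "c < n - k \<Longrightarrow> label_of k n D (Horiz c) = col_label c"
  using label_of_edge_at[OF col_label_range] edge_at_col_label by simp

lemma edge_at_cases:
  assumes "i \<in> {1..n}"
  obtains (vert) r where "r < k" "i = row_label r" "edge_at k n D i = Vert r"
    | (horiz) c where "c < n - k" "i = col_label c" "edge_at k n D i = Horiz c"
proof -
  have "edge_at k n D i \<in> set (se_border k n D)"
    using assms length_se_border by (auto simp: edge_at_def)
  then consider r where "r < k" "edge_at k n D i = Vert r" | c where "c < n - k" "edge_at k n D i = Horiz c"
    unfolding set_se_border by auto
  then show thesis
  proof cases
    case 1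
    then show thesis using vert[of r] label_of_edge_at[OF assms] label_of_Vert[of r] by simp
  next
    case 2
    then show thesis using horiz[of c] label_of_edge_at[OF assms] label_of_Horiz[of c] by simp
  qed
qed

lemma vertical_labels_eq: "vertical_labels k n D = row_label ` {..<k}"
proof
  show "vertical_labels k n D \<subseteq> row_label ` {..<k}"
  proof
    fix i assume "i \<in> vertical_labels k n D"
    then have "i \<in> {1..n}" "\<exists>r. edge_at k n D i = Vert r" by (auto simp: vertical_labels_def)
    from this(1) show "i \<in> row_label ` {..<k}"
      by (cases rule: edge_at_cases) (use \<open>\<exists>r. _\<close> in auto)
  qed
  show "row_label ` {..<k} \<subseteq> vertical_labels k n D"
    using row_label_range edge_at_row_label by (auto simp: vertical_labels_def)
qed

lemma row_label_less:
  assumes "r < r'" "r' < k" shows "row_label r < row_label r'"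
  using lam_antimono[of r r'] lam_le[of r] assms by (auto simp: row_label_def)

lemma row_label_Suc_less: "r < k \<Longrightarrow> row_label r + 1 < n"
  using lam_ge[of r] lam_le[of r] by (auto simp: row_label_def)

text \<open>The exit of a pipe that travels north in column 0 with \<open>q\<close> boxes ahead: the
  \<open>+\<close> at the left end of row \<open>q - 1\<close> turns it out of the diagram at once,
  and for \<open>q = 0\<close> it is already at the top.\<close>

definition pipe_target :: "nat \<Rightarrow> edge" where
  "pipe_target q = (if q = 0 then Horiz 0 else Vert (q - 1))"

lemma pipe_north_first_column: "q \<le> k \<Longrightarrow> pipe_north D q 0 = pipe_target q"
  by (cases q) (auto simp: pipe_target_def D_first)

text \<open>Left of its rightmost box a row holds only zeros up to its first box, whose
  \<open>+\<close> sends the pipe north in column 0.\<close>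

lemma pipe_west_interior:
  assumes "q < k" "1 \<le> c" "c \<le> lam q - 1" shows "pipe_west D q c = pipe_target q"
  using assms(2,3)
proof (induction c)
  case (Suc c)
  then show ?case
    using assms(1) pipe_north_first_column[of q] D_first[of q] D_mid[of q c] by (cases c) auto
qed simp

lemma pipe_north_below_last:
  assumes "r < k" shows "pipe_north D (Suc r) (lam r - 1) = pipe_target r"
  using assms lam_ge[of r] D_last[of r] pipe_west_interior[of r "lam r - 1"] by simp

lemma pipe_west_last:
  assumes "r < k" shows "pipe_west D r (lam r) = pipe_north D r (lam r - 1)"
  using D_last[OF assms] lam_ge[OF assms] by (cases "lam r") auto

text \<open>Row lengths decrease downwards, so the rows containing a column form an initial
  segment.\<close>

lemma less_card_rows_iff: "r < card {r. r < k \<and> c < lam r} \<longleftrightarrow> r < k \<and> c < lam r"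
proof -
  define R where "R = {r. r < k \<and> c < lam r}"
  define m where "m = (LEAST m. m \<notin> R)"
  have "k \<notin> R" by (simp add: R_def)
  then have m: "m \<notin> R" unfolding m_def by (rule LeastI)
  have lt: "r \<in> R" if "r < m" for r using not_less_Least[of r "\<lambda>m. m \<notin> R"] that m_def by auto
  have "r < m" if "r \<in> R" for r
  proof (rule ccontr)
    assume "\<not> r < m"
    then have "m \<in> R" using that lam_antimono[of m r] by (auto simp: R_def)
    then show False using m by simp
  qed
  then have "R = {..<m}" using lt by auto
  then show ?thesis unfolding R_def[symmetric] by (simp add: R_def set_eq_iff)
qed

lemma pipe_end_Horiz: "pipe_end D (Horiz c) = pipe_north D (card {r. r < k \<and> c < lam r}) c"
  by (simp add: length_D)

text \<open>Rows are counted from 1 here and a zeroth value 0 is put in front, as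
  \<open>staircase\<close> requires.\<close>

definition vlabel :: "nat \<Rightarrow> nat" where
  "vlabel i = (if i = 0 then 0 else row_label (i - 1))"

lemma vlabel_Suc: "vlabel (Suc r) = row_label r" by (simp add: vlabel_def)

text \<open>The bound on \<open>vlabel i + 1\<close> comes from the two boxes in each row; it keeps
  the three positions in the support of a basis vector distinct.\<close>

sublocale staircase n k vlabel
proof
  show "strict_mono_on {0..k} vlabel"
  proof (rule strict_mono_onI)
    fix i j assume "i \<in> {0..k}" "j \<in> {0..k}" "i < j"
    then show "vlabel i < vlabel j"
      using row_label_less[of "i - 1" "j - 1"] by (auto simp: vlabel_def row_label_def)
  qed
qed (use n_pos row_label_Suc_less in \<open>auto simp: vlabel_def\<close>)

lemma S_eq_row_labels: "S = row_label ` {..<k}"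
proof
  show "S \<subseteq> row_label ` {..<k}" by (auto simp: vlabel_def)
  show "row_label ` {..<k} \<subseteq> S"
  proof
    fix x assume "x \<in> row_label ` {..<k}"
    then obtain r where "r < k" "x = row_label r" by auto
    then show "x \<in> S" by (intro image_eqI[of _ _ "Suc r"]) (auto simp: vlabel_Suc)
  qed
qed

lemma S_eq: "S = vertical_labels k n D"
  unfolding vertical_labels_eq by (rule S_eq_row_labels)

lemma row_label_in_S: "r < k \<Longrightarrow> row_label r \<in> S"
  unfolding S_eq_row_labels by simp

lemma col_label_notin_S:
  assumes "c < n - k" shows "col_label c \<notin> S"
  using edge_at_col_label[OF assms] unfolding S_eq vertical_labels_def by auto

lemma n_gt_k: "k < n"
  using lam_ge[of 0] lam_le[of 0] n_pos k_le by (cases "k = 0") auto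

lemma rows_nonempty: "card {r. r < k \<and> 0 < lam r} = k"
proof -
  have "{r. r < k \<and> 0 < lam r} = {..<k}"
  proof (intro equalityI subsetI)
    fix r assume "r \<in> {..<k}"
    then show "r \<in> {r. r < k \<and> 0 < lam r}" using lam_ge[of r] by auto
  qed auto
  then show ?thesis by simp
qed

lemma col_label_0: "col_label 0 = n"
  using rows_nonempty k_le by (simp add: col_label_def)

text \<open>Adding \<open>n\<close> before the reduction leaves true labels unchanged and turns the
  zeroth value 0 into \<open>n\<close>, the label of column 0.\<close>

lemma label_of_pipe_target:
  assumes "q \<le> k" shows "label_of k n D (pipe_target q) = (vlabel q + n - 1) mod n + 1"
proof (cases q)
  case 0
  then show ?thesis using label_of_Horiz[of 0] n_gt_k n_pos
    by (simp add: pipe_target_def col_label_0 vlabel_def)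
next
  case (Suc r)
  then have "vlabel q \<in> {1..n}" using row_label_range[of r] assms by (simp add: vlabel_Suc)
  then have "(vlabel q + n - 1) mod n + 1 = vlabel q"
    by (cases "vlabel q") auto
  then show ?thesis using label_of_Vert[of r] Suc assms by (simp add: pipe_target_def vlabel_Suc)
qed

text \<open>Row \<open>r\<close> is the lowest row of its length, so the path turns west right after
  it and runs along the bottom of its last box.\<close>

lemma col_label_last:
  assumes "r < k" "Suc r < k \<Longrightarrow> lam (Suc r) \<noteq> lam r"
  shows "card {q. q < k \<and> lam r - 1 < lam q} = Suc r" "col_label (lam r - 1) = row_label r + 1"
proof -
  have "{q. q < k \<and> lam r - 1 < lam q} = {..<Suc r}"
  proof (intro equalityI subsetI)
    fix q assume q: "q \<in> {q. q < k \<and> lam r - 1 < lam q}"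
    show "q \<in> {..<Suc r}"
    proof (rule ccontr)
      assume "q \<notin> {..<Suc r}"
      then have "lam q \<le> lam (Suc r)" "lam (Suc r) \<le> lam r" "Suc r < k"
        using lam_antimono[of "Suc r" q] lam_antimono[of r "Suc r"] q by auto
      then show False using assms(2) q by auto
    qed
  next
    fix q assume "q \<in> {..<Suc r}"
    then show "q \<in> {q. q < k \<and> lam r - 1 < lam q}"
      using lam_antimono[of q r] lam_ge[of r] assms by auto
  qed
  then show c: "card {q. q < k \<and> lam r - 1 < lam q} = Suc r" by simp
  show "col_label (lam r - 1) = row_label r + 1"
    using lam_ge[of r] lam_le[of r] assms(1) unfolding col_label_def c row_label_def by simp
qed

text \<open>The edge after row \<open>r\<close> is the next vertical step, if that row has the same
  length, or else the bottom of the last box of row \<open>r\<close>. In the first case the pipe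
  turns north at once, so in both cases it enters that last box from below and is turned
  west.\<close>

lemma pipe_end_after:
  assumes "r < k" shows "pipe_end D (edge_at k n D (row_label r + 1)) = pipe_target r"
proof (cases "Suc r < k \<and> lam (Suc r) = lam r")
  case True
  then have "row_label r + 1 = row_label (Suc r)" by (simp add: row_label_def)
  then show ?thesis
    using True edge_at_row_label[of "Suc r"] pipe_west_last[of "Suc r"] pipe_north_below_last[OF assms] by simp
next
  case False
  then have c: "card {q. q < k \<and> lam r - 1 < lam q} = Suc r" "col_label (lam r - 1) = row_label r + 1"
    using col_label_last[OF assms] by auto
  have "lam r - 1 < n - k" using lam_le[OF assms] lam_ge[OF assms] by simp
  then have "edge_at k n D (row_label r + 1) = Horiz (lam r - 1)"
    using edge_at_col_label[of "lam r - 1"] c(2) by simp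
  then show ?thesis using pipe_north_below_last[OF assms] by (simp only: pipe_end_Horiz c(1))
qed

text \<open>The pipe turns north in its first box. Row \<open>r\<close> is the highest of its
  length, so the rows above are strictly longer; column \<open>lam r - 1\<close> is positive and
  lies strictly between their two plusses, where they hold zeros.\<close>

lemma pipe_end_start:
  assumes r: "r < k" and start: "row_label r - 1 \<notin> S"
  shows "pipe_end D (Vert r) = Horiz (lam r - 1)"
proof -
  have "pipe_north D r (lam r - 1) = Horiz (lam r - 1)"
  proof (rule pipe_north_straight)
    fix r' assume r': "r' < r"
    have "lam (r - 1) \<noteq> lam r"
    proof
      assume "lam (r - 1) = lam r"
      then have "row_label r - 1 = row_label (r - 1)" using r' by (simp add: row_label_def)
      moreover have "r - 1 < k" using r by linarith
      ultimately show False using start row_label_in_S[of "r - 1"] by metis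
    qed
    moreover have "r' \<le> r - 1" "r - 1 \<le> r" "r - 1 < k" using r r' by linarith+
    ultimately have "lam r < lam r'"
      using lam_antimono[of r' "r - 1"] lam_antimono[of "r - 1" r] r by linarith
    then show "D ! r' ! (lam r - 1) = Zero" using lam_ge[OF r] r r' by (intro D_mid) auto
  qed
  then show ?thesis using pipe_west_last[OF r] by simp
qed

text \<open>The run starting at row \<open>r\<close> consists of the rows of length
  \<open>lam r\<close>, and the next step of the path lies below their common last column.\<close>

lemma target_start:
  assumes r: "r < k" and start: "row_label r - 1 \<notin> S"
  shows "target (row_label r) = col_label (lam r - 1)"
proof -
  \<comment> \<open>The rows from \<open>r\<close> on that reach column \<open>lam r - 1\<close> are
    \<open>r\<close> to \<open>m - 1\<close>; these form the run.\<close>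
  define m where "m = card {q. q < k \<and> lam r - 1 < lam q}"
  have m: "q < m \<longleftrightarrow> q < k \<and> lam r - 1 < lam q" for q
    unfolding m_def by (rule less_card_rows_iff)
  have rm: "r < m" using m[of r] lam_ge[OF r] r by simp
  have same: "lam q = lam r" if "r \<le> q" "q < m" for q
    using m[of q] that lam_antimono[of r q] lam_ge[OF r] by auto
  have cl: "col_label (lam r - 1) = row_label r + (m - r)"
    using lam_ge[OF r] lam_le[OF r] rm unfolding col_label_def m_def[symmetric] row_label_def by simp
  have "target (vlabel (Suc r)) = col_label (lam r - 1)"
  proof (rule target_run_start)
    show "vlabel (Suc r) < col_label (lam r - 1)" unfolding cl vlabel_Suc using rm by simp
    show "col_label (lam r - 1) \<notin> S" using lam_ge[OF r] lam_le[OF r] by (intro col_label_notin_S) simp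
    fix l assume l: "vlabel (Suc r) \<le> l" "l < col_label (lam r - 1)"
    define q where "q = r + (l - row_label r)"
    have q: "r \<le> q" "q < m" using l rm cl unfolding q_def vlabel_Suc by linarith+
    have "row_label q = l" using same[OF q] l by (simp add: row_label_def q_def vlabel_Suc)
    then show "l \<in> S" using row_label_in_S[of q] m[of q] q by simp
  qed (use r start in \<open>auto simp: vlabel_Suc\<close>)
  then show ?thesis by (simp add: vlabel_Suc)
qed

text \<open>A \<open>+\<close> occurs only in column 0, which carries label \<open>n\<close>, or at
  the right end of a row. In the latter case the lowest row containing column \<open>c\<close> would
  end there too and supply the vertical step just before \<open>i\<close>.\<close>

lemma pipe_end_other:
  assumes c: "c < n - k" and i: "i = col_label c" "i \<noteq> n" "i - 1 \<notin> S"
  shows "pipe_end D (Horiz c) = Horiz c"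
proof -
  define m where "m = card {q. q < k \<and> c < lam q}"
  have m: "q < m \<longleftrightarrow> q < k \<and> c < lam q" for q
    unfolding m_def by (rule less_card_rows_iff)
  have "c \<noteq> 0" using i col_label_0 by auto
  have "pipe_north D m c = Horiz c"
  proof (rule pipe_north_straight)
    fix r assume "r < m"
    then have last: "m - 1 < k" "c < lam (m - 1)" and r: "r < k" "r \<le> m - 1"
      using m[of "m - 1"] m[of r] by auto
    have "lam (m - 1) \<noteq> Suc c"
    proof
      assume *: "lam (m - 1) = Suc c"
      have "i - 1 = row_label (m - 1)"
        using c * \<open>r < m\<close> unfolding i(1) col_label_def m_def[symmetric] row_label_def by simp
      then show False using i(3) row_label_in_S last by simp
    qed
    then have "Suc c < lam r" using last lam_antimono[of r "m - 1"] r by simp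
    then show "D ! r ! c = Zero" using \<open>c \<noteq> 0\<close> r by (intro D_mid) auto
  qed
  then show ?thesis by (simp only: pipe_end_Horiz m_def)
qed

lemma label_of_pipe_end:
  assumes i: "i \<in> {1..n}"
  shows "label_of k n D (pipe_end D (edge_at k n D i)) = (target i - 1) mod n + 1"
  using i
proof (cases rule: index_cases)
  case last
  have "edge_at k n D i = Horiz 0" using edge_at_col_label[of 0] col_label_0 last n_gt_k by simp
  then have "pipe_end D (edge_at k n D i) = pipe_target k"
    using pipe_north_first_column[of k] rows_nonempty by (simp only: pipe_end_Horiz)
  then show ?thesis using label_of_pipe_target[of k] last by (simp add: target_n)
next
  case (after j)
  then obtain r where r: "j = Suc r" "r < k" by (cases j) auto
  have "pipe_end D (edge_at k n D i) = pipe_target r"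
    using pipe_end_after[OF r(2)] after r by (simp add: vlabel_Suc)
  then show ?thesis using label_of_pipe_target[of r] target_Suc[OF after(1)] after(2) r by simp
next
  case (start j)
  then obtain r where r: "j = Suc r" "r < k" by (cases j) auto
  have lt: "lam r - 1 < n - k" using lam_le[OF r(2)] lam_ge[OF r(2)] by simp
  have "pipe_end D (edge_at k n D i) = Horiz (lam r - 1)"
    using pipe_end_start[OF r(2)] edge_at_row_label[OF r(2)] start r by (simp add: vlabel_Suc)
  then have "label_of k n D (pipe_end D (edge_at k n D i)) = col_label (lam r - 1)"
    using label_of_Horiz[OF lt] by simp
  also have "\<dots> = target i" using target_start[OF r(2)] start r by (simp add: vlabel_Suc)
  also have "\<dots> = (target i - 1) mod n + 1"
    using col_label_range[OF lt] \<open>col_label _ = target i\<close> by auto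
  finally show ?thesis .
next
  case other
  have tgt: "(target i - 1) mod n + 1 = i" using target_other[OF other] i by auto
  show ?thesis using i
  proof (cases rule: edge_at_cases)
    case (vert r)
    then show ?thesis using row_label_in_S other by simp
  next
    case (horiz c)
    then show ?thesis unfolding tgt horiz(3)
      using pipe_end_other[OF horiz(1,2)] other label_of_Horiz by simp
  qed
qed

end

section \<open>From decorated permutations to unreduced returns\<close>

lemma mod_window_eq:
  fixes a b i n :: nat
  assumes "1 \<le> i" "i \<le> a" "a < i + n" "i \<le> b" "b < i + n" "(a - 1) mod n = (b - 1) mod n"
  shows "a = b"
proof -
  have "[a - 1 = b - 1] (mod n)" using assms by (simp add: cong_def)
  then have "[(i - 1) + (a - i) = (i - 1) + (b - i)] (mod n)" using assms by simp
  then have "[a - i = b - i] (mod n)" by (simp only: cong_add_lcancel_nat)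
  then have "a - i = b - i" using assms by (simp add: cong_def)
  then show ?thesis using assms by simp
qed

text \<open>Makes every fixed point on the diagram side black. Vertical labels occur only in the
  cases \<open>after\<close> and \<open>start\<close>, where the target is strictly larger.\<close>

lemma (in staircase) fixed_notin_S:
  assumes "i \<in> {1..n}" "target i = i" shows "i \<notin> S"
  using assms(1)
proof (cases rule: index_cases)
  case last
  then show ?thesis using s_Suc_less by fastforce
next
  case (after j)
  then show ?thesis using target_Suc[of j] s_Suc_less[of j] assms(2) by simp
next
  case (start j)
  obtain b where b: "j \<le> b" "b \<le> k" "s b + 1 \<notin> S" "\<And>l. j \<le> l \<Longrightarrow> l < b \<Longrightarrow> s (Suc l) = s l + 1"
    using run_end_exists[OF start(1)] by blast
  have "s j \<le> s b" using s_less_iff[of b j] b start by (auto simp: not_less[symmetric])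
  then show ?thesis using target_run[OF start(1,3) b] assms(2) start by simp
qed

text \<open>Reduction modulo \<open>n\<close> can only confuse the returns \<open>i\<close> and
  \<open>i + n\<close>, and the coloring tells these apart. On the diagram side \<open>i + n\<close>
  never occurs, so equality of decorated permutations lifts to the unreduced returns.\<close>

lemma (in two_plus_diagram) dperm_of_eq_iff:
  assumes "represents k n A V"
  shows "dperm_of k n V = dperm_of_diagram k n D \<longleftrightarrow> (\<forall>i\<in>{1..n}. return_index n V i = target i)"
proof -
  define f where "f = return_index n V"
  define p where "p = (\<lambda>i. if i \<in> {1..n} then (target i - 1) mod n + 1 else i)"
  have rep: "represents k n (SOME A. represents k n A V) V" using assms by (rule someI)
  have fr: "first_return k n (SOME A. represents k n A V) = f"
    using first_return_eq_return_index[OF rep n_pos] by (auto simp: f_def)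
  have L: "dperm_of k n V =
      (\<lambda>i. if i \<in> {1..n} then (f i - 1) mod n + 1 else i,
       \<lambda>i. if i \<in> {1..n} \<and> f i = i then Some Black
           else if i \<in> {1..n} \<and> f i = i + n then Some White else None)"
    unfolding dperm_of_def dperm_of_mat_def fr ..
  have fixp: "p i = i \<longleftrightarrow> target i = i" if "i \<in> {1..n}" for i
  proof
    assume "p i = i"
    then have "(target i - 1) mod n = (i - 1) mod n" using that by (auto simp: p_def)
    then show "target i = i" using mod_window_eq[of i "target i" n i] target_bounds[OF that] that n_pos by auto
  qed (use that in \<open>auto simp: p_def\<close>)
  have R: "dperm_of_diagram k n D =
      (p, \<lambda>i. if i \<in> {1..n} \<and> target i = i then Some Black else None)"
  proof -
    have "(\<lambda>i. if i \<in> {1..n} then label_of k n D (pipe_end D (edge_at k n D i)) else i) = p"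
      using label_of_pipe_end by (auto simp: p_def)
    then show ?thesis unfolding dperm_of_diagram_def Let_def
      using fixp fixed_notin_S by (auto simp: S_eq[symmetric] fun_eq_iff)
  qed
  have fb: "i \<le> f i" "f i \<le> i + n" if "i \<in> {1..n}" for i
    using return_index_bounds[OF n_pos, of i V] that by (auto simp: f_def)
  show ?thesis
  proof
    assume eq: "dperm_of k n V = dperm_of_diagram k n D"
    show "\<forall>i\<in>{1..n}. return_index n V i = target i"
    proof
      fix i assume i: "i \<in> {1..n}"
      have e1: "(f i - 1) mod n + 1 = (target i - 1) mod n + 1"
        using fun_cong[OF arg_cong[OF eq, of fst], of i] i by (simp add: L R p_def)
      have "(if f i = i then Some Black else if f i = i + n then Some White else None) =
          (if target i = i then Some Black else None)"
        using fun_cong[OF arg_cong[OF eq, of snd], of i] unfolding L R snd_conv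
        by (simp only: i simp_thms)
      \<comment> \<open>A return \<open>i + n\<close> would be colored white, which the right-hand
        coloring never is.\<close>
      then have "f i \<noteq> i + n" using n_pos by (auto split: if_splits)
      then have "f i = target i"
        using mod_window_eq[of i "f i" n "target i"] fb[OF i] target_bounds[OF i] e1 i by auto
      then show "return_index n V i = target i" by (simp add: f_def)
    qed
  next
    assume "\<forall>i\<in>{1..n}. return_index n V i = target i"
    then have "f i = target i" if "i \<in> {1..n}" for i using that by (simp add: f_def)
    moreover have "target i \<noteq> i + n" if "i \<in> {1..n}" for i using target_bounds[OF that] by simp
    ultimately show "dperm_of k n V = dperm_of_diagram k n D"
      unfolding L R p_def by (auto simp: fun_eq_iff)
  qed
qed

section \<open>Staircase bases\<close>

definition row_mat :: "nat \<Rightarrow> nat \<Rightarrow> (nat \<Rightarrow> real vec) \<Rightarrow> real mat" where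
  "row_mat k n v = mat k n (\<lambda>(r, c). v (Suc r) $ c)"

locale staircase_vectors = staircase +
  fixes v :: "nat \<Rightarrow> real vec"
  assumes v_supp: "i \<in> {1..k} \<Longrightarrow> j \<in> {1..n} \<Longrightarrow> j \<notin> {s i, s i + 1, n} \<Longrightarrow> coord (v i) j = 0"
    and v_s: "i \<in> {1..k} \<Longrightarrow> coord (v i) (s i) > 0"
    and v_Suc: "i \<in> {1..k} \<Longrightarrow> coord (v i) (s i + 1) > 0"
    and v_n: "i \<in> {1..k} \<Longrightarrow> (-1) ^ (k - i) * coord (v i) n > 0"
begin

section \<open>Nonnegativity of the maximal minors\<close>

lemma v_n_nonzero: "i \<in> {1..k} \<Longrightarrow> coord (v i) n \<noteq> 0"
  using v_n[of i] by auto

lemma v_nonzero_cases: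
  assumes "r < k" "e < n - 1" "v (Suc r) $ e \<noteq> 0"
  shows "Suc e = s (Suc r) \<or> e = s (Suc r)"
proof -
  have "Suc e \<in> {s (Suc r), s (Suc r) + 1, n}"
  proof (rule ccontr)
    assume "Suc e \<notin> {s (Suc r), s (Suc r) + 1, n}"
    then have "coord (v (Suc r)) (Suc e) = 0" using assms by (intro v_supp) auto
    then show False using assms by simp
  qed
  then show ?thesis using assms by auto
qed

lemma v_nonneg:
  assumes "r < k" "e < n - 1" shows "v (Suc r) $ e \<ge> 0"
proof (cases "v (Suc r) $ e = 0")
  case False
  have "s (Suc r) - 1 = e \<or> s (Suc r) + 1 - 1 = e" using v_nonzero_cases[OF assms False] by auto
  then show ?thesis using v_s[of "Suc r"] v_Suc[of "Suc r"] assms by (metis Suc_leI atLeastAtMost_iff le_add1 less_imp_le plus_1_eq_Suc)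
qed simp

text \<open>Outside column \<open>n\<close> each row lives on two adjacent columns, and increasing
  \<open>s\<close> moves these pairs to the right with at most one shared column.\<close>

lemma v_monotone_support:
  assumes "r < r'" "r' < k" "e < n - 1" "e' < n - 1" "v (Suc r) $ e \<noteq> 0" "v (Suc r') $ e' \<noteq> 0"
  shows "e \<le> e'"
  using v_nonzero_cases[of r e] v_nonzero_cases[of r' e'] s_less_iff[of "Suc r" "Suc r'"] assms by auto

text \<open>Away from column \<open>n\<close> only the identity contributes, and its factors are
  nonnegative. Arbitrary row selections are allowed so that the cofactors in the expansion along
  column \<open>n\<close> are covered.\<close>

lemma det_rows_nonneg:
  assumes R: "strict_mono_on {..<m} R" "R ` {..<m} \<subseteq> {..<k}"
    and g: "strict_mono_on {..<m} g" "g ` {..<m} \<subseteq> {..<n - 1}"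
  shows "det (mat m m (\<lambda>(r, c). v (Suc (R r)) $ g c)) \<ge> 0"
proof -
  let ?M = "mat m m (\<lambda>(r, c). v (Suc (R r)) $ g c)"
  have "det ?M = (\<Prod>i<m. ?M $$ (i, i))"
  proof (rule det_monotone_support)
    fix r r' c c'
    assume *: "r < r'" "r' < m" "c < m" "c' < m" "?M $$ (r, c) \<noteq> 0" "?M $$ (r', c') \<noteq> 0"
    then have "g c \<le> g c'"
      using R g strict_mono_onD[OF R(1), of r r'] by (intro v_monotone_support[of "R r" "R r'"]) auto
    then show "c \<le> c'" using strict_mono_on_leD[OF g(1)] strict_mono_onD[OF g(1), of c' c] * by force
  qed simp
  also have "\<dots> \<ge> 0" using R g by (intro prod_nonneg) (auto intro!: v_nonneg)
  finally show ?thesis .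
qed

text \<open>In the expansion along column \<open>n\<close> the sign prescribed by \<open>v_n\<close>
  is precisely the cofactor sign of that row, so every summand is nonnegative.\<close>

lemma minor_nonneg:
  assumes J: "J \<subseteq> {..<n}" "card J = k"
  shows "det (submatrix (row_mat k n v) UNIV J) \<ge> 0"
proof -
  have fin: "finite J" using J finite_subset by blast
  have sm: "strict_mono_on {..<k} (pick J)" using pick_strict_mono[OF fin] J by simp
  have lt: "pick J c < n" if "c < k" for c using pick_lt[OF J(1)] J(2) that by simp
  define M where "M = mat k k (\<lambda>(r, c). v (Suc r) $ pick J c)"
  have M: "M \<in> carrier_mat k k" by (simp add: M_def)
  have sub: "submatrix (row_mat k n v) UNIV J = M"
    using J lt by (subst submatrix_UNIV_eq[of _ k n]) (auto simp: row_mat_def M_def intro!: eq_matI)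
  have "det M \<ge> 0"
  proof (cases "n - 1 \<in> J")
    case False
    have "pick J c < n - 1" if "c < k" for c
      using lt[OF that] pick_in_set_le[of c J] J that False by (metis Suc_pred' less_SucE n_pos)
    then show ?thesis unfolding M_def using sm
      by (intro det_rows_nonneg[of k "\<lambda>r. r"]) (auto intro: strict_mono_onI)
  next
    case True
    \<comment> \<open>If column \<open>n\<close> is chosen at all, it is the last chosen
      one.\<close>
    have "{a \<in> J. a < n - 1} = J - {n - 1}" using J by force
    then have "card {a \<in> J. a < n - 1} = k - 1" using True fin J by simp
    then have last: "pick J (k - 1) = n - 1" using pick_card_in_set[OF True] by simp
    have k: "0 < k" using True fin J by (metis card_gt_0_iff empty_iff)
    have lt': "pick J c < n - 1" if "c < k - 1" for c
      using strict_mono_onD[OF sm, of c "k - 1"] that last by auto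
    have "det M = (\<Sum>i<k. M $$ (i, k - 1) * cofactor M i (k - 1))"
      using k by (intro laplace_expansion_column[OF M]) simp
    also have "\<dots> \<ge> 0"
    proof (rule sum_nonneg)
      fix i assume "i \<in> {..<k}"
      then have i: "i < k" by simp
      let ?R = "\<lambda>r. if r < i then r else Suc r"
      have "mat_delete M i (k - 1) = mat (k - 1) (k - 1) (\<lambda>(r, c). v (Suc (?R r)) $ pick J c)"
        using i by (intro eq_matI) (auto simp: mat_delete_def M_def)
      moreover have "det (mat (k - 1) (k - 1) (\<lambda>(r, c). v (Suc (?R r)) $ pick J c)) \<ge> 0"
      proof (rule det_rows_nonneg)
        show "strict_mono_on {..<k - 1} ?R" by (rule strict_mono_onI) auto
        show "strict_mono_on {..<k - 1} (pick J)"
          by (rule strict_mono_onI) (auto intro!: strict_mono_onD[OF sm])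
      qed (use i lt' in auto)
      ultimately have d: "0 \<le> det (mat_delete M i (k - 1))" by simp
      have "M $$ (i, k - 1) = coord (v (Suc i)) n" using i k last by (simp add: M_def)
      \<comment> \<open>Row \<open>i\<close> of the matrix belongs to \<open>v (Suc i)\<close>, and
        the two exponents have the same parity.\<close>
      moreover have "i + (k - 1) = (k - Suc i) + 2 * i" using i by simp
      then have "(-1 :: real) ^ (i + (k - 1)) = (-1) ^ (k - Suc i)" by (simp add: power_add power_mult)
      ultimately have "M $$ (i, k - 1) * cofactor M i (k - 1) =
          ((-1) ^ (k - Suc i) * coord (v (Suc i)) n) * det (mat_delete M i (k - 1))"
        by (simp add: cofactor_def)
      then show "0 \<le> M $$ (i, k - 1) * cofactor M i (k - 1)"
        using d v_n[of "Suc i"] i by (simp add: mult_nonneg_nonneg)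
    qed
    finally show ?thesis .
  qed
  then show ?thesis by (simp add: sub)
qed

section \<open>Triangular systems for the coefficients of a member of the row space\<close>

lemma row_space_mem_iff:
  assumes "represents k n (row_mat k n v) V"
  shows "w \<in> V \<longleftrightarrow> w \<in> carrier_vec n \<and>
    (\<exists>x. \<forall>l\<in>{1..n}. coord w l = (\<Sum>i=1..k. x i * coord (v i) l))"
proof -
  have eq: "y \<bullet> col (row_mat k n v) c = (\<Sum>i=1..k. y $ (i - 1) * v i $ c)"
    if "y \<in> carrier_vec k" "c < n" for y c
    using that by (simp add: row_mat_def scalar_prod_def lessThan_atLeast0 sum.atLeast1_atMost_eq)
  show ?thesis
  proof
    assume "w \<in> V"
    then obtain y where y: "y \<in> carrier_vec k" "w \<in> carrier_vec n" "\<forall>c<n. w $ c = y \<bullet> col (row_mat k n v) c"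
      using represents_mem_iff[OF assms] by auto
    have "\<forall>l\<in>{1..n}. coord w l = (\<Sum>i=1..k. y $ (i - 1) * coord (v i) l)"
      using y eq by auto
    then show "w \<in> carrier_vec n \<and> (\<exists>x. \<forall>l\<in>{1..n}. coord w l = (\<Sum>i=1..k. x i * coord (v i) l))"
      using y(2) by (intro conjI exI[of _ "\<lambda>i. y $ (i - 1)"]) auto
  next
    assume *: "w \<in> carrier_vec n \<and> (\<exists>x. \<forall>l\<in>{1..n}. coord w l = (\<Sum>i=1..k. x i * coord (v i) l))"
    then obtain x where x: "\<forall>l\<in>{1..n}. coord w l = (\<Sum>i=1..k. x i * coord (v i) l)" by auto
    define y where "y = vec k (\<lambda>i. x (Suc i))"
    have "w $ c = y \<bullet> col (row_mat k n v) c" if "c < n" for c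
    proof -
      have "w $ c = (\<Sum>i=1..k. x i * v i $ c)" using bspec[OF x, of "Suc c"] that by simp
      also have "\<dots> = (\<Sum>i=1..k. y $ (i - 1) * v i $ c)" by (intro sum.cong) (auto simp: y_def)
      finally show ?thesis using eq[of y c] that by (simp add: y_def)
    qed
    then show "w \<in> V" using represents_mem_iff[OF assms] * by (auto simp: y_def intro!: bexI[of _ y])
  qed
qed

lemma v_at_s:
  assumes "i \<in> {1..k}" "j \<in> {1..k}" "i \<noteq> j" "coord (v i) (s j) \<noteq> 0"
  shows "s j = s i + 1"
proof -
  have "s j \<in> {1..n}" "s j \<noteq> n" "s j \<noteq> s i"
    using s_Suc_less[OF assms(2)] s_pos[of j] s_eq_iff[of i j] assms by auto
  then show ?thesis using v_supp[OF assms(1), of "s j"] assms(4) by blast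
qed

lemma v_at_Suc:
  assumes "i \<in> {1..k}" "j \<in> {1..k}" "i \<noteq> j" "coord (v i) (s j + 1) \<noteq> 0"
  shows "s i = s j + 1"
proof -
  have "s j + 1 \<in> {1..n}" "s j + 1 \<noteq> n" "s j + 1 \<noteq> s i + 1"
    using s_Suc_less[OF assms(2)] s_eq_iff[of i j] assms by auto
  then show ?thesis using v_supp[OF assms(1), of "s j + 1"] assms(4) by (metis insert_iff empty_iff)
qed

lemma sum_single:
  assumes j: "j \<in> {1..k}" and z: "\<And>i. i \<in> {1..k} \<Longrightarrow> i \<noteq> j \<Longrightarrow> x i * coord (v i) l = 0"
  shows "(\<Sum>i=1..k. x i * coord (v i) l) = x j * coord (v j) l"
proof -
  have "(\<Sum>i\<in>{1..k} - {j}. x i * coord (v i) l) = 0"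
    by (rule sum.neutral) (use z in blast)
  then show ?thesis using j by (subst sum.remove[of _ j]) auto
qed

text \<open>Forward substitution: column \<open>s l\<close> meets only \<open>v l\<close> and
  possibly a vector of smaller index.\<close>

lemma coeffs_zero_upward:
  assumes x: "\<And>l. l \<in> {1..n} \<Longrightarrow> coord w l = (\<Sum>i=1..k. x i * coord (v i) l)"
    and m: "m \<le> k" and z: "\<And>l. l \<in> {1..m} \<Longrightarrow> coord w (s l) = 0"
  shows "l \<in> {1..m} \<Longrightarrow> x l = 0"
proof (induction l rule: less_induct)
  case (less l)
  then have l: "l \<in> {1..k}" using m by auto
  have "coord w (s l) = (\<Sum>i=1..k. x i * coord (v i) (s l))"
    using x s_pos[of l] s_Suc_less[OF l] l by auto
  also have "\<dots> = x l * coord (v l) (s l)"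
  proof (rule sum_single[OF l])
    fix i assume i: "i \<in> {1..k}" "i \<noteq> l"
    show "x i * coord (v i) (s l) = 0"
    proof (cases "coord (v i) (s l) = 0")
      case False
      then have "i < l" using v_at_s[of i l] i l s_less_iff[of i l] by auto
      then show ?thesis using less i by auto
    qed simp
  qed
  finally show ?case using z[OF less.prems] v_s[OF l] by auto
qed

text \<open>Backward substitution: besides \<open>v l\<close>, column \<open>s l + 1\<close> meets
  at most the vector whose label is \<open>s l + 1\<close>. The gap after \<open>s b\<close> keeps
  the index of that vector at most \<open>b\<close>, which makes \<open>b\<close> a valid starting
  point.\<close>

lemma coeffs_zero_downward:
  assumes x: "\<And>l. l \<in> {1..n} \<Longrightarrow> coord w l = (\<Sum>i=1..k. x i * coord (v i) l)"
    and b: "b \<le> k" "s b + 1 \<notin> S" and z: "\<And>l. l \<in> {m..b} \<Longrightarrow> coord w (s l + 1) = 0"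
  shows "1 \<le> m \<Longrightarrow> l \<in> {m..b} \<Longrightarrow> x l = 0"
proof (induction "b - l" arbitrary: l rule: less_induct)
  case less
  then have l: "l \<in> {1..k}" using b by auto
  have "coord w (s l + 1) = (\<Sum>i=1..k. x i * coord (v i) (s l + 1))"
    using s_Suc_less[OF l] by (intro x) auto
  also have "\<dots> = x l * coord (v l) (s l + 1)"
  proof (rule sum_single[OF l])
    fix i assume i: "i \<in> {1..k}" "i \<noteq> l"
    show "x i * coord (v i) (s l + 1) = 0"
    proof (cases "coord (v i) (s l + 1) = 0")
      case False
      then have si: "s i = s l + 1" using v_at_Suc i l by blast
      then have "l < i" using s_less_iff[of l i] i l by auto
      moreover have "i \<le> b"
      proof (rule ccontr)
        assume "\<not> i \<le> b"
        then have "s b < s i" using s_less_iff[of b i] b i by auto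
        moreover have "s l \<le> s b" using s_less_iff[of b l] less.prems l b by auto
        ultimately have "s b + 1 = s i" using si by simp
        then show False using b(2) i(1) by simp
      qed
      ultimately have "x i = 0" using less by auto
      then show ?thesis by simp
    qed simp
  qed
  finally show ?case using z[OF less.prems(2)] v_Suc[OF l] by auto
qed

lemma s_k_Suc_notin_S: "s k + 1 \<notin> S"
proof
  assume "s k + 1 \<in> S"
  then obtain i where "i \<in> {1..k}" "s i = s k + 1" by auto
  then show False using s_less_iff[of k i] by auto
qed

section \<open>First returns of the space spanned by a staircase basis\<close>

context
  fixes V :: "real vec set"
  assumes rep: "represents k n (row_mat k n v) V" and vc: "\<And>i. i \<in> {1..k} \<Longrightarrow> v i \<in> carrier_vec n"
begin

lemma V_coeffs:
  assumes "w \<in> V"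
  obtains x where "\<And>l. l \<in> {1..n} \<Longrightarrow> coord w l = (\<Sum>i=1..k. x i * coord (v i) l)"
  using assms row_space_mem_iff[OF rep] by auto

lemma v_mem: "i \<in> {1..k} \<Longrightarrow> v i \<in> V"
  unfolding row_space_mem_iff[OF rep]
proof (intro conjI exI ballI)
  fix l assume i: "i \<in> {1..k}"
  show "v i \<in> carrier_vec n" using vc i by simp
  show "coord (v i) l = (\<Sum>j=1..k. (if j = i then 1 else 0) * coord (v j) l)"
    using i by (subst sum_single[of i]) auto
qed

text \<open>Shows that the first label of a run does not return before the end of the run. Starting
  from \<open>v j\<close>, each step clears the next label with the vector belonging to it, which
  vanishes at all earlier labels of the run.\<close>

lemma run_witness:
  assumes j: "j \<in> {1..k}" and b: "b \<le> k"
    and run: "\<And>l. j \<le> l \<Longrightarrow> l < b \<Longrightarrow> s (Suc l) = s l + 1"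
  shows "j + d \<le> b \<Longrightarrow> \<exists>w\<in>V. coord w (s j) \<noteq> 0 \<and> (\<forall>l\<in>{s j<..s j + d}. coord w l = 0)"
proof (induction d)
  case 0
  then show ?case using v_mem[OF j] v_s[OF j] by (intro bexI[of _ "v j"]) auto
next
  case (Suc d)
  then obtain w where w: "w \<in> V" "coord w (s j) \<noteq> 0" "\<forall>l\<in>{s j<..s j + d}. coord w l = 0" by auto
  let ?i = "j + Suc d"
  have i: "?i \<in> {1..k}" using Suc b j by auto
  have si: "s ?i = s j + Suc d" using s_run[of j b ?i] run Suc.prems by simp
  define w' where "w' = coord (v ?i) (s ?i) \<cdot>\<^sub>v w - coord w (s ?i) \<cdot>\<^sub>v v ?i"
  have c: "w \<in> carrier_vec n" "v ?i \<in> carrier_vec n" using w row_space_mem_iff[OF rep] vc[OF i] by auto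
  have eq: "coord w' l = coord (v ?i) (s ?i) * coord w l - coord w (s ?i) * coord (v ?i) l" if "l \<in> {1..n}" for l
    using that c by (auto simp: w'_def)
  have lt: "s ?i < n" using s_Suc_less[OF i] by simp
  have z: "coord (v ?i) l = 0" if "l \<in> {s j..s j + d}" for l
    using that lt si s_pos[of j] j by (intro v_supp[OF i]) auto
  have "coord w' (s j) \<noteq> 0"
    using w(2) v_s[OF i] z[of "s j"] lt si s_pos[of j] j by (subst eq) auto
  moreover have "coord w' l = 0" if "l \<in> {s j<..s j + Suc d}" for l
  proof (cases "l = s ?i")
    case True
    then show ?thesis using lt si by (subst eq) auto
  next
    case False
    then show ?thesis using that si w(3) z[of l] lt by (subst eq) auto
  qed
  moreover have "w' \<in> V" unfolding w'_def using w(1) v_mem[OF i] by (rule represents_combination[OF rep])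
  ultimately show ?case by blast
qed

lemma return_index_eq_target:
  assumes i: "i \<in> {1..n}" shows "return_index n V i = target i"
proof -
  note iff = return_index_eq_iff[OF n_pos, of i "target i" V]
  have cyc: "cyc n w l = coord w l" if "l \<in> {1..n}" for w :: "real vec" and l
    using that by (rule cyc_eq_coord)
  have wrap: "coord w l = 0" if "\<forall>l\<in>{a<..b + n}. cyc n w l = 0" "l \<in> {1..n}" "l \<le> b" "a < n + l"
    for w :: "real vec" and l a b
    using that cyc_wrap[of l w n] cyc[OF that(2), of w]
    by (metis add.commute add_le_cancel_right atLeastAtMost_iff greaterThanAtMost_iff)
  have "detects n V i (target i) \<and> (i < target i \<longrightarrow> \<not> detects n V i (target i - 1))"
    using i
  proof (cases rule: index_cases)
    case last
    \<comment> \<open>The window from \<open>n + 1\<close> to \<open>s k + n\<close> wraps around to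
      all vertical labels, so forward substitution kills all coefficients.\<close>
    have "detects n V i (target i)" unfolding detects_def target_n last
    proof (intro ballI impI)
      fix w assume w: "w \<in> V" and z: "\<forall>l\<in>{n<..s k + n}. cyc n w l = 0"
      obtain x where x: "\<And>l. l \<in> {1..n} \<Longrightarrow> coord w l = (\<Sum>i=1..k. x i * coord (v i) l)"
        using V_coeffs[OF w] by blast
      have "coord w (s l) = 0" if "l \<in> {1..k}" for l
        using wrap[OF z, of "s l"] that s_pos[of l] s_Suc_less[OF that] s_less_iff[of k l] by auto
      then have "x l = 0" if "l \<in> {1..k}" for l using coeffs_zero_upward[OF x, of k l] that by blast
      then show "cyc n w n = 0" using x[of n] n_pos by (subst cyc) auto
    qed
    moreover have "\<not> detects n V i (target i - 1)" if "i < target i"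
    proof -
      \<comment> \<open>For \<open>k = 0\<close> the target is \<open>n\<close> itself and nothing
        is to be refuted. Otherwise \<open>v k\<close> is the witness: it vanishes before
        \<open>s k\<close> but not at \<open>n\<close>.\<close>
      have k: "k \<in> {1..k}" using that s_0 unfolding last target_n by (cases "k = 0") auto
      have "cyc n (v k) l = 0" if "l \<in> {n<..s k + n - 1}" for l
      proof -
        have l: "l - n \<in> {1..n}" "l - n < s k" using that s_k_less by auto
        have "cyc n (v k) l = cyc n (v k) (l - n)" using cyc_wrap[of "l - n" "v k" n] l by auto
        also have "\<dots> = coord (v k) (l - n)" by (rule cyc[OF l(1)])
        also have "\<dots> = 0" using l s_k_less by (intro v_supp[OF k]) auto
        finally show ?thesis .
      qed
      moreover have "cyc n (v k) n \<noteq> 0" using v_n_nonzero[OF k] n_pos by (subst cyc) auto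
      ultimately show ?thesis unfolding detects_def last target_n using v_mem[OF k] by blast
    qed
    ultimately show ?thesis by blast
  next
    case (after j)
    note j = after(1)
    have tgt: "target (s j + 1) = s (j - 1) + n" by (rule target_Suc[OF j])
    have pred: "s (j - 1) < s j" using s_less_iff[of "j - 1" j] j by auto
    \<comment> \<open>The window covers the labels after \<open>s j + 1\<close> and, once around,
      those up to \<open>s (j - 1)\<close>. The latter clear the coefficients below
      \<open>j\<close>, the former those above \<open>j\<close>, and the entry at \<open>n\<close>
      then clears \<open>x j\<close>.\<close>
    have "detects n V i (target i)" unfolding after(2) tgt detects_def
    proof (intro ballI impI)
      fix w assume w: "w \<in> V" and z: "\<forall>l\<in>{s j + 1<..s (j - 1) + n}. cyc n w l = 0"
      obtain x where x: "\<And>l. l \<in> {1..n} \<Longrightarrow> coord w l = (\<Sum>i=1..k. x i * coord (v i) l)"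
        using V_coeffs[OF w] by blast
      have z': "coord w l = 0" if "l \<in> {s j + 1<..n}" for l
        using z that cyc[of l w] by auto
      have "coord w (s l) = 0" if "l \<in> {1..j - 1}" for l
      proof -
        have l: "l \<in> {1..k}" "l \<le> j - 1" "j - 1 \<le> k" using that j by auto
        then have "s l \<le> s (j - 1)" using s_less_iff[of "j - 1" l] by auto
        then show ?thesis
          using wrap[OF z, of "s l"] s_pos[of l] s_Suc_less[OF l(1)] s_Suc_less[OF j] l by auto
      qed
      then have x1: "x l = 0" if "l \<in> {1..j - 1}" for l
        using coeffs_zero_upward[OF x, of "j - 1" l] that j by auto
      have "coord w (s l + 1) = 0" if "l \<in> {Suc j..k}" for l
        using that s_less_iff[of j l] s_Suc_less[of l] j by (intro z') auto
      then have x2: "x l = 0" if "l \<in> {Suc j..k}" for l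
        using coeffs_zero_downward[OF x order_refl s_k_Suc_notin_S, of "Suc j" l] that by auto
      have x0: "x l = 0" if "l \<in> {1..k}" "l \<noteq> j" for l
        using x1[of l] x2[of l] that by (cases "l < j") auto
      have eq: "coord w l = x j * coord (v j) l" if "l \<in> {1..n}" for l
        unfolding x[OF that] using x0 by (intro sum_single[OF j]) auto
      have "x j = 0" using eq[of n] z'[of n] v_n_nonzero[OF j] s_Suc_less[OF j] by auto
      then show "cyc n w (s j + 1) = 0" using eq[of "s j + 1"] s_Suc_less[OF j] by (subst cyc) auto
    qed
    moreover have "\<not> detects n V i (target i - 1)"
    proof (cases "j = 1")
      case True
      \<comment> \<open>For \<open>j = 1\<close> the shortened window ends at \<open>n - 1\<close>,
        so \<open>v j\<close> itself is a witness.\<close>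
      have "cyc n (v j) l = 0" if "l \<in> {s j + 1<..n - 1}" for l
      proof -
        have l: "l \<in> {1..n}" "l \<notin> {s j, s j + 1, n}" using that by auto
        show ?thesis using cyc[OF l(1), of "v j"] v_supp[OF j l] by simp
      qed
      moreover have "cyc n (v j) (s j + 1) \<noteq> 0"
        using v_Suc[OF j] s_Suc_less[OF j] by (subst cyc) auto
      moreover have "s (j - 1) + n - 1 = n - 1" using True s_0 by simp
      ultimately show ?thesis unfolding after(2) tgt detects_def using v_mem[OF j] by metis
    next
      case False
      then have j': "j - 1 \<in> {1..k}" using j by auto
      \<comment> \<open>Of the supports of both vectors the shortened window contains only
        \<open>n\<close>, where this combination cancels.\<close>
      define w where "w = coord (v j) n \<cdot>\<^sub>v v (j - 1) - coord (v (j - 1)) n \<cdot>\<^sub>v v j"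
      have eq: "coord w l = coord (v j) n * coord (v (j - 1)) l - coord (v (j - 1)) n * coord (v j) l"
        if "l \<in> {1..n}" for l using that vc[OF j] vc[OF j'] by (auto simp: w_def)
      have "w \<in> V" unfolding w_def using v_mem[OF j'] v_mem[OF j] by (rule represents_combination[OF rep])
      moreover have "cyc n w l = 0" if l: "l \<in> {s j + 1<..s (j - 1) + n - 1}" for l
      proof (cases "l \<le> n")
        case True
        then have "coord w l = 0"
          using l pred v_supp[OF j, of l] v_supp[OF j', of l] eq[of l] by (cases "l = n") auto
        then show ?thesis using True l by (subst cyc) auto
      next
        case False
        then have l': "l - n \<in> {1..n}" "l - n < s (j - 1)" using l s_Suc_less[OF j] pred by auto
        have "cyc n w l = cyc n w (l - n)" using cyc_wrap[of "l - n" w n] l' False by auto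
        also have "\<dots> = coord w (l - n)" by (rule cyc[OF l'(1)])
        also have "\<dots> = 0" using eq[OF l'(1)] v_supp[OF j l'(1)] v_supp[OF j' l'(1)] l' pred s_Suc_less[OF j] by auto
        finally show ?thesis .
      qed
      moreover have "cyc n w (s j + 1) \<noteq> 0"
        using eq[of "s j + 1"] v_supp[OF j', of "s j + 1"] pred v_Suc[OF j] v_n_nonzero[OF j'] s_Suc_less[OF j]
        by (subst cyc) auto
      ultimately show ?thesis unfolding after(2) tgt detects_def by blast
    qed
    ultimately show ?thesis by blast
  next
    case (start j)
    note j = start(1)
    obtain b where b: "j \<le> b" "b \<le> k" "s b + 1 \<notin> S" and run: "\<And>l. j \<le> l \<Longrightarrow> l < b \<Longrightarrow> s (Suc l) = s l + 1"
      using run_end_exists[OF j] by blast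
    have tgt: "target (s j) = s b + 1" by (rule target_run[OF j start(3) b run])
    have sb: "s b = s j + (b - j)" using s_run[of j b b] run b by simp
    have bk: "b \<in> {1..k}" using b j by auto
    have "detects n V i (target i)" unfolding start(2) tgt detects_def
    proof (intro ballI impI)
      fix w assume w: "w \<in> V" and z: "\<forall>l\<in>{s j<..s b + 1}. cyc n w l = 0"
      obtain x where x: "\<And>l. l \<in> {1..n} \<Longrightarrow> coord w l = (\<Sum>i=1..k. x i * coord (v i) l)"
        using V_coeffs[OF w] by blast
      have "coord w (s l + 1) = 0" if "l \<in> {j..b}" for l
      proof -
        have l: "s j \<le> s l" "s l \<le> s b" "s l + 1 < n"
          using that s_less_iff[of l j] s_less_iff[of b l] b j s_Suc_less[of l] by auto
        then have "cyc n w (s l + 1) = 0" by (intro bspec[OF z]) auto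
        then show ?thesis using l cyc[of "s l + 1" w] by auto
      qed
      then have "x l = 0" if "l \<in> {j..b}" for l
        using coeffs_zero_downward[OF x b(2,3), of j l] that j by auto
      then have xj: "x j = 0" using b by auto
      \<comment> \<open>No other vector reaches the first label of a run, because
        \<open>s j - 1\<close> is not vertical.\<close>
      have "coord w (s j) = x j * coord (v j) (s j)"
      proof (subst x)
        show "(\<Sum>i=1..k. x i * coord (v i) (s j)) = x j * coord (v j) (s j)"
        proof (rule sum_single[OF j])
          fix l assume l: "l \<in> {1..k}" "l \<noteq> j"
          have "coord (v l) (s j) = 0"
          proof (rule ccontr)
            assume "coord (v l) (s j) \<noteq> 0"
            then have "s j - 1 = s l" using v_at_s[of l j] l j by auto
            then show False using start(3) l by simp
          qed
          then show "x l * coord (v l) (s j) = 0" by simp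
        qed
      qed (use i start in auto)
      then show "cyc n w (s j) = 0" using xj cyc[of "s j" w] i start by simp
    qed
    moreover have "\<not> detects n V i (target i - 1)"
    proof -
      obtain w where w: "w \<in> V" "coord w (s j) \<noteq> 0" "\<forall>l\<in>{s j<..s j + (b - j)}. coord w l = 0"
        using run_witness[OF j b(2) run, of "b - j"] b by auto
      have "cyc n w l = 0" if "l \<in> {s j<..s b + 1 - 1}" for l
        using that w(3) sb s_Suc_less[OF bk] by (subst cyc) auto
      moreover have "cyc n w (s j) \<noteq> 0" using w(2) cyc[of "s j" w] i start by simp
      ultimately show ?thesis unfolding start(2) tgt detects_def using w(1) by blast
    qed
    ultimately show ?thesis by blast
  next
    case other
    have "detects n V i i" unfolding detects_def
    proof (intro ballI impI)
      fix w assume w: "w \<in> V"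
      obtain x where x: "\<And>l. l \<in> {1..n} \<Longrightarrow> coord w l = (\<Sum>i=1..k. x i * coord (v i) l)"
        using V_coeffs[OF w] by blast
      have "coord (v l) i = 0" if "l \<in> {1..k}" for l
      proof -
        have "i \<noteq> s l" "i \<noteq> s l + 1" using other that by auto
        then show ?thesis using v_supp[OF that i] other by auto
      qed
      then show "cyc n w i = 0" using x[OF i] cyc[OF i, of w] by simp
    qed
    then show ?thesis using target_other[OF other] by simp
  qed
  then show ?thesis using iff target_bounds[OF i] i by auto
qed

end

end

section \<open>Signs in the positroid cell\<close>

context staircase begin

section \<open>Counting vertical labels in intervals\<close>

lemma S_subset: "S \<subseteq> {1..<n}"
  using s_pos s_Suc_less by fastforce

lemma inj_s: "inj_on s {1..k}"
  using s_eq_iff by (auto simp: inj_on_def)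

lemma card_S: "card S = k"
  using inj_s by (simp add: card_image)

lemma card_s_image: "1 \<le> a \<Longrightarrow> b \<le> k \<Longrightarrow> card (s ` {a..b}) = Suc b - a"
  using inj_on_subset[OF inj_s, of "{a..b}"] by (subst card_image) auto

lemma s_image_between:
  assumes "i \<le> k" "b \<le> k"
  shows "{t \<in> S. s i < t \<and> t < s b + 1} = s ` {Suc i..b}"
proof -
  have eq: "{l \<in> {1..k}. s i < s l \<and> s l < s b + 1} = {Suc i..b}"
  proof (intro equalityI subsetI)
    fix l assume "l \<in> {l \<in> {1..k}. s i < s l \<and> s l < s b + 1}"
    then show "l \<in> {Suc i..b}" using s_less_iff[of i l] s_less_iff[of b l] assms by auto
  next
    fix l assume "l \<in> {Suc i..b}"
    then show "l \<in> {l \<in> {1..k}. s i < s l \<and> s l < s b + 1}"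
      using s_less_iff[of i l] s_less_iff[of b l] assms by auto
  qed
  have "{t \<in> S. s i < t \<and> t < s b + 1} = s ` {l \<in> {1..k}. s i < s l \<and> s l < s b + 1}" by auto
  then show ?thesis unfolding eq .
qed

lemma s_image_after:
  assumes "i \<le> k" shows "{t \<in> S. s i < t \<and> t < n} = s ` {Suc i..k}"
proof -
  have "{t \<in> S. s i < t \<and> t < n} = {t \<in> S. s i < t \<and> t < s k + 1}"
    using S_subset s_less_iff[of k] by (auto simp: less_Suc_eq_le not_less[symmetric])
  then show ?thesis using s_image_between[OF assms order_refl] by simp
qed

lemma run_start_exists:
  assumes "j \<in> {1..k}"
  obtains a where "1 \<le> a" "a \<le> j" "s a - 1 \<notin> S" "\<And>l. a \<le> l \<Longrightarrow> l < j \<Longrightarrow> s (Suc l) = s l + 1"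
  using assms
proof (induction j arbitrary: thesis rule: less_induct)
  case (less j)
  show ?case
  proof (cases "s j - 1 \<in> S")
    case False
    then show thesis using less.prems by (intro less.prems(1)[of j]) auto
  next
    case True
    then obtain i where i: "i \<in> {1..k}" "s j - 1 = s i" by (rule imageE) auto
    have sj: "s j = s i + 1" using i s_pos[of j] less.prems by auto
    then have "i < j" using s_less_iff[of i j] i less.prems by auto
    moreover have "\<not> Suc i < j"
    proof
      assume "Suc i < j"
      then have "s i < s (Suc i)" "s (Suc i) < s j"
        using s_less_iff[of i "Suc i"] s_less_iff[of "Suc i" j] less.prems by auto
      then show False using sj by simp
    qed
    ultimately have j: "j = Suc i" by simp
    obtain a where "1 \<le> a" "a \<le> i" "s a - 1 \<notin> S" "\<And>l. a \<le> l \<Longrightarrow> l < i \<Longrightarrow> s (Suc l) = s l + 1"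
      using less.IH[of i] i j by auto
    then show thesis using sj j by (intro less.prems(1)[of a]) (auto simp: less_Suc_eq)
  qed
qed

lemma run_end_unique:
  assumes "j \<le> b" "b \<le> k" "s b + 1 \<notin> S" "\<And>l. j \<le> l \<Longrightarrow> l < b \<Longrightarrow> s (Suc l) = s l + 1"
    and "j \<le> b'" "b' \<le> k" "s b' + 1 \<notin> S" "\<And>l. j \<le> l \<Longrightarrow> l < b' \<Longrightarrow> s (Suc l) = s l + 1"
  shows "b = b'"
proof (rule ccontr)
  have no: "\<not> c < c'" if "j \<le> c" "c' \<le> k" "s c + 1 \<notin> S" "\<And>l. j \<le> l \<Longrightarrow> l < c' \<Longrightarrow> s (Suc l) = s l + 1" for c c'
  proof
    assume "c < c'"
    then have "s c + 1 = s (Suc c)" "Suc c \<in> {1..k}" using that by auto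
    then show False using that(3) by (metis imageI)
  qed
  assume "b \<noteq> b'"
  then show False using no[of b b'] no[of b' b] assms by (meson linorder_neqE_nat)
qed

end

locale staircase_cell = staircase +
  fixes V :: "real vec set" and A :: "real mat"
  assumes rep: "represents k n A V"
    and dim_V: "vectorspace.dim class_ring (subspace_vs n V) = k"
    and minors: "J \<subseteq> {..<n} \<Longrightarrow> card J = k \<Longrightarrow> det (submatrix A UNIV J) \<ge> 0"
    and ret: "i \<in> {1..n} \<Longrightarrow> return_index n V i = target i"
begin

section \<open>Vanishing of coordinates forced by the returns\<close>

lemma V_carrier: "w \<in> V \<Longrightarrow> w \<in> carrier_vec n"
  using represents_mem_iff[OF rep] by simp

lemma A_carrier: "A \<in> carrier_mat k n"
  using rep by (simp add: represents_def)

lemma target_detects: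
  assumes "i \<in> {1..n}"
  shows "detects n V i (target i)" "i < target i \<Longrightarrow> \<not> detects n V i (target i - 1)"
  using return_index_eq_iff[OF n_pos, of i "target i" V] ret[OF assms] target_bounds(1)[OF assms] assms
  by auto

lemma forward_rule:
  assumes "w \<in> V" "i \<in> {1..n}" "\<And>l. l \<in> {i<..target i} \<Longrightarrow> cyc n w l = 0"
  shows "coord w i = 0"
  using target_detects(1)[OF assms(2)] assms(1,3) cyc_eq_coord[OF assms(2), of w]
  unfolding detects_def by auto

text \<open>By minimality of \<open>target i\<close> some \<open>u\<close> vanishes strictly between
  \<open>i\<close> and \<open>target i\<close> but not at \<open>i\<close>. If \<open>w\<close> were
  nonzero at \<open>target i\<close>, clearing that entry of \<open>u\<close> with \<open>w\<close>
  would contradict the forward rule.\<close>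

lemma backward_rule:
  assumes w: "w \<in> V" and i: "i \<in> {1..n}" "i < target i"
    and z: "\<And>l. l \<in> {i..<target i} \<Longrightarrow> cyc n w l = 0"
  shows "cyc n w (target i) = 0"
proof (rule ccontr)
  assume nz: "cyc n w (target i) \<noteq> 0"
  obtain u where u: "u \<in> V" "\<forall>l\<in>{i<..target i - 1}. cyc n u l = 0" "cyc n u i \<noteq> 0"
    using target_detects(2)[OF i] unfolding detects_def by blast
  define u' where "u' = cyc n w (target i) \<cdot>\<^sub>v u - cyc n u (target i) \<cdot>\<^sub>v w"
  have eq: "cyc n u' l = cyc n w (target i) * cyc n u l - cyc n u (target i) * cyc n w l" for l
    using V_carrier[OF u(1)] V_carrier[OF w] n_pos by (simp add: u'_def)
  have "u' \<in> V" unfolding u'_def by (rule represents_combination[OF rep u(1) w])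
  moreover have "cyc n u' l = 0" if "l \<in> {i<..target i}" for l
  proof (cases "l = target i")
    case True
    then show ?thesis using eq[of l] by (simp add: mult.commute)
  next
    case False
    have "cyc n u l = 0" by (rule bspec[OF u(2)]) (use that False in auto)
    moreover have "cyc n w l = 0" by (rule z) (use that False in auto)
    ultimately show ?thesis using eq[of l] by simp
  qed
  ultimately have "coord u' i = 0" using forward_rule i(1) by blast
  then have "cyc n u' i = 0" using cyc_eq_coord[OF i(1)] by simp
  then show False using eq[of i] z[of i] i(2) u(3) nz by simp
qed

lemma cyc_split:
  assumes "l \<in> {1..2 * n}"
  shows "cyc n w l = (if l \<le> n then coord w l else coord w (l - n))"
proof (cases "l \<le> n")
  case True
  then show ?thesis using cyc_eq_coord[of l n w] assms by auto
next
  case False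
  then show ?thesis using cyc_wrap[of "l - n" w n] cyc_eq_coord[of "l - n" n w] assms by auto
qed

lemma zero_column:
  assumes "w \<in> V" "i \<in> {1..n}" "i \<noteq> n" "i - 1 \<notin> S" "i \<notin> S"
  shows "coord w i = 0"
  using forward_rule[OF assms(1,2)] target_other[OF assms(3-5)] by simp

text \<open>The return of \<open>i\<close> takes less than a full turn, so its window avoids
  \<open>i\<close>; thus \<open>V\<close> contains no nonzero multiple of a unit vector.\<close>

lemma single_support:
  assumes w: "w \<in> V" and i: "i \<in> {1..n}" and z: "\<And>l. l \<in> {1..n} \<Longrightarrow> l \<noteq> i \<Longrightarrow> coord w l = 0"
  shows "coord w i = 0"
proof (rule forward_rule[OF w i])
  fix l assume l: "l \<in> {i<..target i}"
  then have lt: "l < i + n" using target_bounds(2)[OF i] by simp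
  show "cyc n w l = 0"
  proof (cases "l \<le> n")
    case True
    then show ?thesis using l i cyc_split[of l w] z[of l] by auto
  next
    case False
    then have "l - n \<in> {1..n}" "l - n \<noteq> i" "l \<in> {1..2 * n}" using lt i by auto
    then show ?thesis using False cyc_split[of l w] z[of "l - n"] by presburger
  qed
qed

text \<open>The backward rule at the first label \<open>s a\<close>: the labels from there up to its
  target are exactly the run.\<close>

lemma run_end_zero:
  assumes w: "w \<in> V" and b: "b \<in> {1..k}" "s b + 1 \<notin> S"
    and a: "1 \<le> a" "a \<le> b" "s a - 1 \<notin> S" "\<And>l. a \<le> l \<Longrightarrow> l < b \<Longrightarrow> s (Suc l) = s l + 1"
    and z: "\<And>l. l \<in> {a..b} \<Longrightarrow> coord w (s l) = 0"
  shows "coord w (s b + 1) = 0"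
proof -
  have a': "a \<in> {1..k}" using a b by auto
  have tgt: "target (s a) = s b + 1" using target_run[OF a' a(3,2) _ b(2) a(4)] b by simp
  have sb: "s b = s a + (b - a)" using s_run[of a b b] a by simp
  have "cyc n w (target (s a)) = 0"
  proof (rule backward_rule[OF w])
    show "s a \<in> {1..n}" using s_pos[of a] s_Suc_less[OF a'] a' by auto
    show "s a < target (s a)" unfolding tgt sb by simp
    fix l assume l: "l \<in> {s a..<target (s a)}"
    define m where "m = a + (l - s a)"
    have m: "m \<in> {a..b}" using l a(2) unfolding tgt sb m_def by auto
    have "s m = l" using s_run[of a b m] a(4) m l by (simp add: m_def)
    then have "coord w l = 0" using z[OF m] by simp
    moreover have "l \<in> {1..n}" using l s_Suc_less[OF b(1)] s_pos[of a] a' unfolding tgt by auto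
    ultimately show "cyc n w l = 0" using cyc_eq_coord by metis
  qed
  then show ?thesis unfolding tgt using cyc_eq_coord[of "s b + 1" n w] s_Suc_less[OF b(1)] by simp
qed

text \<open>The start of the run is left unnamed; the hypothesis ranges over all indices joined to
  \<open>b\<close> by consecutive labels.\<close>

lemma run_end_zero':
  assumes w: "w \<in> V" and b: "b \<in> {1..k}" "s b + 1 \<notin> S"
    and z: "\<And>l. l \<in> {1..b} \<Longrightarrow> (\<And>m. l \<le> m \<Longrightarrow> m < b \<Longrightarrow> s (Suc m) = s m + 1) \<Longrightarrow> coord w (s l) = 0"
  shows "coord w (s b + 1) = 0"
proof -
  obtain a where a: "1 \<le> a" "a \<le> b" "s a - 1 \<notin> S" "\<And>l. a \<le> l \<Longrightarrow> l < b \<Longrightarrow> s (Suc l) = s l + 1"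
    using run_start_exists[OF b(1)] by blast
  have "coord w (s l) = 0" if "l \<in> {a..b}" for l
    using that a by (intro z) auto
  then show ?thesis using run_end_zero[OF w b a] by blast
qed

text \<open>Labels behind a run follow by the backward rule, and other nonvertical labels below
  \<open>n\<close> are zero columns. Label \<open>n\<close> comes last, as its window wraps around
  to labels already cleared.\<close>

lemma S_separating:
  assumes w: "w \<in> V" and z: "\<And>t. t \<in> S \<Longrightarrow> coord w t = 0"
  shows "l \<in> {1..n} \<Longrightarrow> coord w l = 0"
proof -
  have below: "coord w l = 0" if l: "l \<in> {1..<n}" for l
  proof -
    consider "l \<in> S" | "l \<notin> S" "l - 1 \<in> S" | "l \<notin> S" "l - 1 \<notin> S" by blast
    then show ?thesis
    proof cases
      case 2
      then obtain b where b: "b \<in> {1..k}" "l - 1 = s b" by (meson imageE)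
      then have lb: "l = s b + 1" using l by auto
      have "coord w (s m) = 0" if "m \<in> {1..b}" for m
        using that b by (intro z) auto
      then show ?thesis unfolding lb
        using 2 lb by (intro run_end_zero'[OF w b(1)]) auto
    qed (use z zero_column[OF w] l in auto)
  qed
  moreover have "coord w n = 0"
  proof (rule forward_rule[OF w])
    fix l assume "l \<in> {n<..target n}"
    then have l: "n < l" "l - n \<in> {1..<n}" "l \<in> {1..2 * n}" using s_k_less by (auto simp: target_n)
    then show "cyc n w l = 0" using cyc_split[OF l(3), of w] below[OF l(2)] by simp
  qed (use n_pos in auto)
  ultimately show "l \<in> {1..n} \<Longrightarrow> coord w l = 0" by (cases "l = n") auto
qed

text \<open>Dual form of saying that the columns in \<open>T\<close> are a basis of the column
  space.\<close>

definition separating :: "nat set \<Rightarrow> bool" where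
  "separating T \<longleftrightarrow> T \<subseteq> {1..n} \<and> card T = k \<and>
    (\<forall>w\<in>V. (\<forall>t\<in>T. coord w t = 0) \<longrightarrow> (\<forall>l\<in>{1..n}. coord w l = 0))"

lemma S_is_separating: "separating S"
  using S_subset card_S S_separating by (fastforce simp: separating_def)

section \<open>Signs of entries from nonnegative minors\<close>

lemma pred_image:
  assumes "T \<subseteq> {1..n}"
  shows "(\<lambda>t. t - 1) ` T \<subseteq> {..<n}" "card ((\<lambda>t. t - 1) ` T) = card T"
proof -
  have "inj_on (\<lambda>t. t - 1) T"
  proof (rule inj_onI)
    fix x y assume "x \<in> T" "y \<in> T" "x - 1 = y - 1"
    moreover from this have "1 \<le> x" "1 \<le> y" using assms by auto
    ultimately show "x = y" by linarith
  qed
  then show "card ((\<lambda>t. t - 1) ` T) = card T" by (rule card_image)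
  show "(\<lambda>t. t - 1) ` T \<subseteq> {..<n}" using assms by force
qed

lemma separating_minor_pos:
  assumes "separating T" shows "det (submatrix A UNIV ((\<lambda>t. t - 1) ` T)) > 0"
proof -
  let ?T = "(\<lambda>t. t - 1) ` T"
  have T: "T \<subseteq> {1..n}" "card T = k" using assms by (auto simp: separating_def)
  have "det (submatrix A UNIV ?T) \<noteq> 0"
  proof (rule minor_nonzero_if_separating[OF A_carrier])
    fix y assume y: "y \<in> carrier_vec k" "\<And>c. c \<in> ?T \<Longrightarrow> y \<bullet> col A c = 0"
    define w where "w = vec n (\<lambda>c. y \<bullet> col A c)"
    have "w \<in> V" using represents_mem_iff[OF rep, of w] y(1) by (auto simp: w_def)
    moreover have "coord w t = 0" if "t \<in> T" for t
      using y(2)[of "t - 1"] that pred_image(1)[OF T(1)] by (auto simp: w_def)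
    ultimately have "\<forall>l\<in>{1..n}. coord w l = 0" using assms by (simp add: separating_def)
    then have "y \<bullet> col A c = 0" if "c < n" for c
    proof -
      have "coord w (Suc c) = 0"
        by (rule bspec[OF \<open>\<forall>l\<in>{1..n}. coord w l = 0\<close>]) (use that in simp)
      then show ?thesis using that by (simp add: w_def)
    qed
    then show "y = 0\<^sub>v k" by (intro represents_rows_independent[OF rep dim_V y(1)])
  qed (use pred_image[OF T(1)] T in auto)
  moreover have "det (submatrix A UNIV ?T) \<ge> 0"
    using minors pred_image[OF T(1)] T by simp
  ultimately show ?thesis by simp
qed

text \<open>In the circuit relation for \<open>insert x T\<close> only the terms of \<open>p\<close>
  and \<open>x\<close> survive. The minor without \<open>x\<close> is positive and the one without
  \<open>p\<close> is nonnegative, so the number of labels of \<open>T\<close> between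
  \<open>p\<close> and \<open>x\<close> decides the relative sign of the two entries.\<close>

lemma sign_rule:
  assumes T: "separating T" and w: "w \<in> V" and p: "p \<in> T" and x: "x \<in> {1..n}" "x \<notin> T" "p < x"
    and z: "\<And>t. t \<in> T \<Longrightarrow> t \<noteq> p \<Longrightarrow> coord w t = 0"
  shows "(-1) ^ card {t \<in> T. p < t \<and> t < x} * (coord w p * coord w x) \<ge> 0"
proof -
  let ?f = "\<lambda>t :: nat. t - 1"
  have Tn: "T \<subseteq> {1..n}" "card T = k" using T by (auto simp: separating_def)
  have finT: "finite T" using Tn(1) finite_subset by blast
  define J where "J = insert x T"
  have J: "J \<subseteq> {1..n}" "card J = Suc k" "finite J" using Tn x finT by (auto simp: J_def)
  have inj: "inj_on ?f J" using pred_image(2)[OF J(1)] J(3) by (simp add: eq_card_imp_inj_on)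
  have pJ: "p \<in> J" "x \<in> J" "p \<noteq> x" using p x by (auto simp: J_def)
  obtain y where y: "y \<in> carrier_vec k" "\<And>c. c < n \<Longrightarrow> w $ c = y \<bullet> col A c"
    using w represents_mem_iff[OF rep] by blast
  define g where "g = (\<lambda>e. (-1) ^ card {a\<in>?f ` J. a < e} * w $ e * det (submatrix A UNIV (?f ` J - {e})))"
  have "sum g (?f ` J) = 0"
    unfolding g_def using row_space_circuit_relation[OF A_carrier pred_image(1)[OF J(1)] _ y] pred_image(2)[OF J(1)] J(2) by simp
  then have "(\<Sum>t\<in>J. g (?f t)) = 0" using inj by (simp add: sum.reindex)
  moreover have "(\<Sum>t\<in>J. g (?f t)) = (\<Sum>t\<in>{p, x}. g (?f t))"
  proof (rule sum.mono_neutral_right)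
    show "\<forall>t\<in>J - {p, x}. g (?f t) = 0" using z by (auto simp: g_def J_def)
  qed (use J pJ in auto)
  ultimately have rel: "g (?f p) + g (?f x) = 0" using pJ by simp
  have less: "?f a < ?f b \<longleftrightarrow> a < b" if "a \<in> J" "b \<in> J" for a b
  proof -
    have "1 \<le> a" "1 \<le> b" using that J(1) by auto
    then show ?thesis by linarith
  qed
  have cnt: "card {a\<in>?f ` J. a < ?f e} = card {t\<in>J. t < e}" if "e \<in> J" for e
  proof -
    have "{a\<in>?f ` J. a < ?f e} = ?f ` {t\<in>J. t < e}" using less that by auto
    then show ?thesis using inj by (simp add: card_image inj_on_subset)
  qed
  let ?N = "card {t\<in>J. t < p}" and ?M = "card {t\<in>T. p < t \<and> t < x}"
  \<comment> \<open>\<open>p\<close> itself is counted too; the extra \<open>-1\<close> carries the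
    second term to the other side of the relation with sign \<open>(-1) ^ ?M\<close>.\<close>
  have "{t\<in>J. t < x} = insert p ({t\<in>J. t < p} \<union> {t\<in>T. p < t \<and> t < x})"
    using p x by (auto simp: J_def)
  moreover have "card \<dots> = Suc (card ({t\<in>J. t < p} \<union> {t\<in>T. p < t \<and> t < x}))"
    using J finT by (subst card_insert_disjoint) auto
  moreover have "card ({t\<in>J. t < p} \<union> {t\<in>T. p < t \<and> t < x}) = ?N + ?M"
    using J finT by (intro card_Un_disjoint) auto
  ultimately have Nx: "card {t\<in>J. t < x} = Suc (?N + ?M)" by simp
  have diffx: "?f ` J - {?f x} = ?f ` T"
    using inj pJ x(2) by (auto simp: J_def inj_on_def)
  define P where "P = det (submatrix A UNIV (?f ` J - {?f p}))"
  define Q where "Q = det (submatrix A UNIV (?f ` T))"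
  have Q: "Q > 0" unfolding Q_def by (rule separating_minor_pos[OF T])
  have P: "P \<ge> 0" unfolding P_def
  proof (rule minors)
    show "card (?f ` J - {?f p}) = k" using pred_image(2)[OF J(1)] J pJ by (subst card_Diff_singleton) auto
  qed (use pred_image(1)[OF J(1)] in auto)
  have "(-1) ^ ?N * coord w p * P + (-1) ^ Suc (?N + ?M) * coord w x * Q = 0"
    using rel unfolding g_def cnt[OF pJ(1)] cnt[OF pJ(2)] Nx diffx P_def Q_def by simp
  then have "(-1) ^ ?N * (coord w p * P - (-1) ^ ?M * coord w x * Q) = 0"
    by (simp add: power_add algebra_simps)
  then have "coord w p * P = (-1) ^ ?M * coord w x * Q" by simp
  \<comment> \<open>Multiplying by the entry at \<open>p\<close> turns one side into a square times
    a nonnegative minor.\<close>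
  then have "((-1) ^ ?M * (coord w p * coord w x)) * Q = coord w p * (coord w p * P)"
    by (simp only: mult.assoc mult.left_commute)
  also have "\<dots> = (coord w p)\<^sup>2 * P" by (simp add: power2_eq_square)
  also have "\<dots> \<ge> 0" using P by simp
  finally show ?thesis using Q by (simp add: zero_le_mult_iff)
qed

end

section \<open>The basis dual to the vertical columns\<close>

lemma (in staircase_cell) dual_vector:
  assumes "j \<in> {1..k}"
  shows "\<exists>w\<in>V. coord w (s j) = 1 \<and> (\<forall>i\<in>{1..k}. i \<noteq> j \<longrightarrow> coord w (s i) = 0)"
proof -
  let ?T = "(\<lambda>t. t - 1) ` S"
  have "S \<subseteq> {1..n}" using S_subset by auto
  then have T: "?T \<subseteq> {..<n}" "card ?T = k" using pred_image[of S] card_S by simp_all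
  have nz: "det (submatrix A UNIV ?T) \<noteq> 0" using separating_minor_pos[OF S_is_separating] by simp
  have pT: "s j - 1 \<in> ?T" using assms by auto
  obtain y where y: "y \<in> carrier_vec k" "\<And>c. c \<in> ?T \<Longrightarrow> y \<bullet> col A c = (if c = s j - 1 then 1 else 0)"
    using dual_basis_on_columns[OF A_carrier T nz pT] by blast
  define w where "w = vec n (\<lambda>c. y \<bullet> col A c)"
  have w: "w \<in> V" using represents_mem_iff[OF rep, of w] y(1) by (auto simp: w_def)
  have "coord w (s i) = (if i = j then 1 else 0)" if i: "i \<in> {1..k}" for i
  proof -
    have iT: "s i - 1 \<in> ?T" using i by auto
    then have "s i - 1 < n" using T(1) by blast
    then have "coord w (s i) = (if s i - 1 = s j - 1 then 1 else 0)"
      using y(2)[OF iT] by (simp only: w_def index_vec)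
    moreover have "s i - 1 = s j - 1 \<longleftrightarrow> i = j"
      using s_eq_iff[of i j] s_pos[of i] s_pos[of j] i assms by auto
    ultimately show ?thesis by simp
  qed
  then show ?thesis using w assms by (intro bexI[of _ w]) auto
qed

definition (in staircase_cell) dual :: "nat \<Rightarrow> real vec" where
  "dual j = (SOME w. w \<in> V \<and> coord w (s j) = 1 \<and> (\<forall>i\<in>{1..k}. i \<noteq> j \<longrightarrow> coord w (s i) = 0))"

context staircase_cell begin

lemma dual_spec:
  assumes "j \<in> {1..k}"
  shows dual_mem: "dual j \<in> V" and dual_self: "coord (dual j) (s j) = 1"
    and dual_other: "i \<in> {1..k} \<Longrightarrow> i \<noteq> j \<Longrightarrow> coord (dual j) (s i) = 0"
proof -
  have "\<exists>w. w \<in> V \<and> coord w (s j) = 1 \<and> (\<forall>i\<in>{1..k}. i \<noteq> j \<longrightarrow> coord w (s i) = 0)"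
    using dual_vector[OF assms] by blast
  from someI_ex[OF this, folded dual_def]
  show "dual j \<in> V" "coord (dual j) (s j) = 1" "i \<in> {1..k} \<Longrightarrow> i \<noteq> j \<Longrightarrow> coord (dual j) (s i) = 0"
    by auto
qed

text \<open>\<open>j\<close> may lie anywhere in its run and only the end \<open>b\<close> is
  maximal, so tails of runs are again runs and \<open>b\<close> is determined by
  \<open>j\<close>.\<close>

definition is_run :: "nat \<Rightarrow> nat \<Rightarrow> bool" where
  "is_run j b \<longleftrightarrow> 1 \<le> j \<and> j \<le> b \<and> b \<le> k \<and> s b + 1 \<notin> S \<and> (\<forall>l. j \<le> l \<and> l < b \<longrightarrow> s (Suc l) = s l + 1)"

lemma is_run_exists: "j \<in> {1..k} \<Longrightarrow> \<exists>b. is_run j b"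
  using run_end_exists[of j] unfolding is_run_def by (metis atLeastAtMost_iff)

lemma is_run_unique: "is_run j b \<Longrightarrow> is_run j b' \<Longrightarrow> b = b'"
  unfolding is_run_def by (rule run_end_unique[of j]) auto

lemma is_run_s:
  assumes "is_run j b" "j \<le> i" "i \<le> b" shows "s i = s j + (i - j)"
  using s_run[of j b i] assms by (auto simp: is_run_def)

lemma is_run_tail: "is_run j b \<Longrightarrow> j \<le> i \<Longrightarrow> i \<le> b \<Longrightarrow> is_run i b"
  by (auto simp: is_run_def)

text \<open>A nonvertical label right behind another run vanishes by the backward rule, since the
  dual vector is zero on that whole run. The remaining labels are vertical or zero columns.\<close>

lemma dual_support:
  assumes run: "is_run j b" and l: "l \<in> {1..n}" "l \<noteq> s j" "l \<noteq> s b + 1" "l \<noteq> n"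
  shows "coord (dual j) l = 0"
proof -
  have j: "j \<in> {1..k}" using run by (auto simp: is_run_def)
  consider i where "i \<in> {1..k}" "l = s i" | "l \<notin> S" "l - 1 \<in> S" | "l \<notin> S" "l - 1 \<notin> S" by blast
  then show ?thesis
  proof cases
    case 1
    then show ?thesis using dual_other[OF j] l by auto
  next
    case 2
    then obtain b' where b': "b' \<in> {1..k}" "l - 1 = s b'" by (meson imageE)
    then have lb: "l = s b' + 1" using l by auto
    have "coord (dual j) (s m) = 0" if m: "m \<in> {1..b'}" "\<And>i. m \<le> i \<Longrightarrow> i < b' \<Longrightarrow> s (Suc i) = s i + 1" for m
    proof -
      have "is_run m b'" using m b' 2 lb by (auto simp: is_run_def)
      then have "m \<noteq> j" using is_run_unique[OF run] l lb by blast
      then show ?thesis using dual_other[OF j, of m] m b' by auto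
    qed
    then show ?thesis unfolding lb using 2 lb by (intro run_end_zero'[OF dual_mem[OF j] b'(1)]) auto
  next
    case 3
    then show ?thesis using zero_column[OF dual_mem[OF j] l(1,4)] by blast
  qed
qed

text \<open>The sign rule for \<open>S\<close> with \<open>p = s i\<close> and \<open>x = n\<close>:
  there are \<open>k - i\<close> vertical labels in between.\<close>

lemma sign_at_n:
  assumes "i \<in> {1..k}" "w \<in> V" "coord w (s i) = 1" "\<And>l. l \<in> {1..k} \<Longrightarrow> l \<noteq> i \<Longrightarrow> coord w (s l) = 0"
  shows "(-1) ^ (k - i) * coord w n \<ge> 0"
proof -
  have "card {t \<in> S. s i < t \<and> t < n} = k - i"
    using s_image_after[of i] card_s_image[of "Suc i" k] assms(1) by simp
  moreover have "(-1) ^ card {t \<in> S. s i < t \<and> t < n} * (coord w (s i) * coord w n) \<ge> 0"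
  proof (rule sign_rule[OF S_is_separating assms(2)])
    show "n \<notin> S" "s i < n" using S_subset s_Suc_less[OF assms(1)] by auto
    fix t assume t: "t \<in> S" "t \<noteq> s i"
    then obtain l where "l \<in> {1..k}" "t = s l" by blast
    then show "coord w t = 0" using assms(4)[of l] t(2) by blast
  qed (use assms(1) n_pos in auto)
  ultimately show ?thesis using assms(3) by simp
qed

lemma c_sign:
  assumes run: "is_run j b" shows "(-1) ^ (b - j) * coord (dual j) (s b + 1) \<ge> 0"
proof -
  have j: "j \<in> {1..k}" and b: "b \<in> {1..k}" "j \<le> b" "s b + 1 \<notin> S" using run by (auto simp: is_run_def)
  have "card {t \<in> S. s j < t \<and> t < s b + 1} = b - j"
    using s_image_between[of j b] card_s_image[of "Suc j" b] j b by simp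
  moreover have "(-1) ^ card {t \<in> S. s j < t \<and> t < s b + 1} * (coord (dual j) (s j) * coord (dual j) (s b + 1)) \<ge> 0"
  proof (rule sign_rule[OF S_is_separating dual_mem[OF j]])
    show "s b + 1 \<in> {1..n}" using s_Suc_less[OF b(1)] by simp
    show "s j < s b + 1" using is_run_s[OF run b(2)] by simp
    fix t assume t: "t \<in> S" "t \<noteq> s j"
    then obtain l where "l \<in> {1..k}" "t = s l" by blast
    then show "coord (dual j) t = 0" using dual_other[OF j, of l] t(2) by blast
  qed (use j b in auto)
  ultimately show ?thesis using dual_self[OF j] by simp
qed

text \<open>The window of the first label of a run consists of the rest of the run and the label
  behind it; if the claim failed, the dual vector would vanish on all of it.\<close>

lemma c_start_nonzero:
  assumes run: "is_run a b" and start: "s a - 1 \<notin> S"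
  shows "coord (dual a) (s b + 1) \<noteq> 0"
proof
  assume z: "coord (dual a) (s b + 1) = 0"
  have a: "a \<in> {1..k}" and b: "b \<in> {1..k}" "a \<le> b" using run by (auto simp: is_run_def)
  have tgt: "target (s a) = s b + 1"
    using run by (intro target_run[OF a start]) (auto simp: is_run_def)
  have "coord (dual a) (s a) = 0"
  proof (rule forward_rule[OF dual_mem[OF a]])
    show "s a \<in> {1..n}" using S_subset a by fastforce
    fix l assume l: "l \<in> {s a<..target (s a)}"
    then have ln: "l \<in> {1..n}" "l \<noteq> n" using tgt s_Suc_less[OF b(1)] by auto
    have "coord (dual a) l = 0"
      using dual_support[OF run ln(1) _ _ ln(2)] z l by (cases "l = s b + 1") auto
    then show "cyc n (dual a) l = 0" using cyc_eq_coord[OF ln(1)] by simp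
  qed
  then show False using dual_self[OF a] by simp
qed

section \<open>Exchanging a vertical label for the label behind its run\<close>

definition exchanged :: "nat \<Rightarrow> nat \<Rightarrow> nat set" where
  "exchanged m b = insert (s b + 1) (S - {s m})"

text \<open>Clearing the entry at \<open>s m\<close> with the dual vector reduces to
  \<open>S\<close>; the entry at \<open>s b + 1\<close> then shows that there was nothing to
  clear.\<close>

lemma exchanged_separating:
  assumes run: "is_run m b" and nz: "coord (dual m) (s b + 1) \<noteq> 0"
  shows "separating (exchanged m b)"
  unfolding separating_def
proof (intro conjI ballI impI)
  have m: "m \<in> {1..k}" and b: "b \<in> {1..k}" "s b + 1 \<notin> S" using run by (auto simp: is_run_def)
  have h: "s b + 1 \<in> {1..n}" using s_Suc_less[OF b(1)] by simp
  show "exchanged m b \<subseteq> {1..n}" using S_subset h by (auto simp: exchanged_def)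
  have "s m \<in> S" "finite S" using m by auto
  then show "card (exchanged m b) = k"
    using b card_S m unfolding exchanged_def by (subst card_insert_disjoint) (auto simp: card_Diff_singleton)
  fix w l assume w: "w \<in> V" and z: "\<forall>t\<in>exchanged m b. coord w t = 0" and l: "l \<in> {1..n}"
  define w' where "w' = 1 \<cdot>\<^sub>v w - coord w (s m) \<cdot>\<^sub>v dual m"
  have eq: "coord w' i = coord w i - coord w (s m) * coord (dual m) i" if "i \<in> {1..n}" for i
    using that V_carrier[OF w] V_carrier[OF dual_mem[OF m]] by (auto simp: w'_def)
  have w': "w' \<in> V" unfolding w'_def by (rule represents_combination[OF rep w dual_mem[OF m]])
  have z': "coord w' t = 0" if t: "t \<in> S" for t
  proof -
    obtain i where i: "i \<in> {1..k}" "t = s i" using t by auto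
    have tn: "t \<in> {1..n}" using t S_subset by auto
    show ?thesis
    proof (cases "i = m")
      case True
      then show ?thesis using eq[OF tn] dual_self[OF m] i by simp
    next
      case False
      then have "t \<in> exchanged m b" using i m s_eq_iff[of i m] by (auto simp: exchanged_def)
      then show ?thesis using eq[OF tn] z dual_other[OF m i(1) False] i by simp
    qed
  qed
  have "coord w' (s b + 1) = 0" using S_separating[OF w' z' h] .
  then have "coord w (s m) = 0" using eq[OF h] z nz by (simp add: exchanged_def)
  moreover have "coord w' l = 0" using S_separating[OF w' z' l] .
  ultimately show "coord w l = 0" using eq[OF l] by simp
qed

text \<open>Compared with \<open>S\<close>, the set gains \<open>s b + 1\<close> and loses
  \<open>s m\<close>. The loss lies beyond \<open>s i\<close> only if \<open>i < m\<close>, so the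
  parity flips exactly for \<open>i \<ge> m\<close>.\<close>

lemma card_exchanged_after:
  assumes run: "is_run m b" and i: "1 \<le> i" "i \<le> b"
  shows "card {t \<in> exchanged m b. s i < t \<and> t < n} = (if i < m then k - i else Suc (k - i))"
proof -
  have m: "m \<in> {1..k}" and b: "b \<in> {1..k}" "s b + 1 \<notin> S" using run by (auto simp: is_run_def)
  have ib: "s i \<le> s b" using s_less_iff[of b i] i b by auto
  have "{t \<in> exchanged m b. s i < t \<and> t < n} = insert (s b + 1) ({t \<in> S. s i < t \<and> t < n} - {s m})"
    using ib s_Suc_less[OF b(1)] by (auto simp: exchanged_def)
  moreover have "{t \<in> S. s i < t \<and> t < n} = s ` {Suc i..k}" using i b by (intro s_image_after) auto
  moreover have "s b + 1 \<notin> s ` {Suc i..k} - {s m}" using b i by auto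
  ultimately have "card {t \<in> exchanged m b. s i < t \<and> t < n} = Suc (card (s ` {Suc i..k} - {s m}))"
    by simp
  also have "\<dots> = (if i < m then k - i else Suc (k - i))"
  proof (cases "i < m")
    case True
    then have "s m \<in> s ` {Suc i..k}" using m by auto
    then show ?thesis using True card_s_image[of "Suc i" k] i m by (simp add: card_Diff_singleton)
  next
    case False
    then have "s m \<notin> s ` {Suc i..k}" using s_eq_iff m by fastforce
    then show ?thesis using False card_s_image[of "Suc i" k] by simp
  qed
  finally show ?thesis .
qed

text \<open>The sign rule for the exchanged basis. The entry at \<open>s m\<close> is unconstrained
  because \<open>s m\<close> has left the basis; in return the entry at \<open>s b + 1\<close> must
  vanish.\<close>

lemma sign_exchanged:
  assumes run: "is_run m b" and nz: "coord (dual m) (s b + 1) \<noteq> 0" and i: "i \<in> {1..k}" "i \<le> b" "i \<noteq> m"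
    and w: "w \<in> V" "coord w (s i) = 1" "coord w (s b + 1) = 0"
    and z: "\<And>l. l \<in> {1..k} \<Longrightarrow> l \<noteq> i \<Longrightarrow> l \<noteq> m \<Longrightarrow> coord w (s l) = 0"
  shows "(-1) ^ (if i < m then k - i else Suc (k - i)) * coord w n \<ge> 0"
proof -
  have m: "m \<in> {1..k}" and b: "b \<in> {1..k}" using run by (auto simp: is_run_def)
  have "(-1) ^ card {t \<in> exchanged m b. s i < t \<and> t < n} * (coord w (s i) * coord w n) \<ge> 0"
  proof (rule sign_rule[OF exchanged_separating[OF run nz] w(1)])
    show "s i \<in> exchanged m b" using i m s_eq_iff[of i m] by (auto simp: exchanged_def)
    show "n \<notin> exchanged m b" using S_subset s_Suc_less[OF b] by (auto simp: exchanged_def)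
    show "s i < n" using s_Suc_less[OF i(1)] by simp
    fix t assume t: "t \<in> exchanged m b" "t \<noteq> s i"
    show "coord w t = 0"
    proof (cases "t = s b + 1")
      case False
      then obtain l where "l \<in> {1..k}" "t = s l" "t \<noteq> s m" using t(1) by (auto simp: exchanged_def)
      then show ?thesis using z[of l] t(2) by blast
    qed (use w(3) in simp)
  qed (use n_pos in auto)
  then show ?thesis using card_exchanged_after[OF run _ i(2)] i w(2) by simp
qed

text \<open>Exchanging the start of the run reverses the sign at \<open>n\<close> that
  \<open>S\<close> forces, so a zero at \<open>s b + 1\<close> would bring a zero at
  \<open>n\<close> and leave the dual vector supported on \<open>s i\<close> alone.\<close>

lemma c_nonzero:
  assumes run: "is_run i b" shows "coord (dual i) (s b + 1) \<noteq> 0"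
proof
  assume z: "coord (dual i) (s b + 1) = 0"
  have i: "i \<in> {1..k}" "i \<le> b" "b \<in> {1..k}" using run by (auto simp: is_run_def)
  obtain a where a: "1 \<le> a" "a \<le> i" "s a - 1 \<notin> S" "\<And>l. a \<le> l \<Longrightarrow> l < i \<Longrightarrow> s (Suc l) = s l + 1"
    using run_start_exists[OF i(1)] by blast
  have run_a: "is_run a b" using run a unfolding is_run_def by (metis le_trans not_le)
  have nz: "coord (dual a) (s b + 1) \<noteq> 0" by (rule c_start_nonzero[OF run_a a(3)])
  then have "i \<noteq> a" using z by auto
  then have "(-1) ^ Suc (k - i) * coord (dual i) n \<ge> 0"
    using sign_exchanged[OF run_a nz i(1,2) _ dual_mem[OF i(1)] dual_self[OF i(1)] z] dual_other[OF i(1)] a by auto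
  moreover have "(-1) ^ (k - i) * coord (dual i) n \<ge> 0"
    by (rule sign_at_n[OF i(1) dual_mem[OF i(1)] dual_self[OF i(1)] dual_other[OF i(1)]])
  ultimately have "coord (dual i) n = 0" by auto
  have "coord (dual i) (s i) = 0"
  proof (rule single_support[OF dual_mem[OF i(1)]])
    show "s i \<in> {1..n}" using i S_subset by fastforce
    fix l assume "l \<in> {1..n}" "l \<noteq> s i"
    then show "coord (dual i) l = 0"
      using dual_support[OF run] z \<open>coord (dual i) n = 0\<close> by (cases "l = s b + 1"; cases "l = n") auto
  qed
  then show False using dual_self[OF i(1)] by simp
qed

lemma c_pos:
  assumes run: "is_run j b" shows "(-1) ^ (b - j) * coord (dual j) (s b + 1) > 0"
  using c_sign[OF run] c_nonzero[OF run] by (simp add: less_le)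

text \<open>The window of \<open>s i + 1\<close> ends at \<open>s (i - 1)\<close> one turn later,
  hence meets the support of \<open>u\<close> at most in \<open>n\<close>.\<close>

lemma coord_n_nonzero:
  assumes u: "u \<in> V" and i: "i \<in> {1..k}"
    and supp: "\<And>l. l \<in> {1..n} \<Longrightarrow> l \<notin> {s i, s i + 1, n} \<Longrightarrow> coord u l = 0"
    and nz: "coord u (s i + 1) \<noteq> 0"
  shows "coord u n \<noteq> 0"
proof
  assume z: "coord u n = 0"
  have pred: "s (i - 1) < s i" using s_less_iff[of "i - 1" i] i by auto
  have "coord u (s i + 1) = 0"
  proof (rule forward_rule[OF u])
    show "s i + 1 \<in> {1..n}" using s_Suc_less[OF i] by simp
    fix l assume "l \<in> {s i + 1<..target (s i + 1)}"
    then have l: "s i + 1 < l" "l \<le> s (i - 1) + n" unfolding target_Suc[OF i] by auto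
    have l2: "l \<in> {1..2 * n}" using l pred s_Suc_less[OF i] by auto
    show "cyc n u l = 0"
    proof (cases "l \<le> n")
      case True
      then have "coord u l = 0" using supp[of l] z l by (cases "l = n") auto
      then show ?thesis using cyc_split[OF l2] True by simp
    next
      case False
      then have "coord u (l - n) = 0" using l pred s_Suc_less[OF i] by (intro supp) auto
      then show ?thesis using cyc_split[OF l2] False by simp
    qed
  qed
  then show False using nz by simp
qed

lemma staircase_vector_exists:
  assumes i: "i \<in> {1..k}"
  shows "\<exists>u\<in>V. (\<forall>l\<in>{1..n}. l \<notin> {s i, s i + 1, n} \<longrightarrow> coord u l = 0) \<and>
    coord u (s i) > 0 \<and> coord u (s i + 1) > 0 \<and> (-1) ^ (k - i) * coord u n > 0"
proof -
  obtain b where run: "is_run i b" using is_run_exists[OF i] by blast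
  have b: "b \<in> {1..k}" "i \<le> b" using run by (auto simp: is_run_def)
  have "\<exists>u\<in>V. (\<forall>l\<in>{1..n}. l \<notin> {s i, s i + 1, n} \<longrightarrow> coord u l = 0) \<and>
      coord u (s i) = 1 \<and> coord u (s i + 1) > 0 \<and> (-1) ^ (k - i) * coord u n \<ge> 0"
  proof (cases "i = b")
    case True
    \<comment> \<open>At the end of a run the label behind the run is \<open>s i + 1\<close>, so the
      dual vector itself works.\<close>
    have "(-1) ^ (k - i) * coord (dual i) n \<ge> 0"
      by (rule sign_at_n[OF i dual_mem[OF i] dual_self[OF i] dual_other[OF i]])
    then show ?thesis using dual_mem[OF i] dual_self[OF i] dual_support[OF run] c_pos[OF run] True
      by (intro bexI[of _ "dual i"]) auto
  next
    case False
    let ?i = "Suc i"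
    have i': "?i \<in> {1..k}" using False b i by auto
    have run': "is_run ?i b" using is_run_tail[OF run, of ?i] False b by auto
    have si: "s ?i = s i + 1" using run False b by (auto simp: is_run_def)
    \<comment> \<open>Chosen so that the entries at \<open>s b + 1\<close>, the label behind the
      run, cancel.\<close>
    define t where "t = coord (dual i) (s b + 1) / coord (dual ?i) (s b + 1)"
    define u where "u = 1 \<cdot>\<^sub>v dual i - t \<cdot>\<^sub>v dual ?i"
    have eq: "coord u l = coord (dual i) l - t * coord (dual ?i) l" if "l \<in> {1..n}" for l
      using that V_carrier[OF dual_mem[OF i]] V_carrier[OF dual_mem[OF i']] by (auto simp: u_def)
    have uV: "u \<in> V" unfolding u_def by (rule represents_combination[OF rep dual_mem[OF i] dual_mem[OF i']])
    have sn: "s l \<in> {1..n}" if "l \<in> {1..k}" for l using S_subset that by fastforce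
    have h: "s b + 1 \<in> {1..n}" using s_Suc_less[OF b(1)] by simp
    have uh: "coord u (s b + 1) = 0" using eq[OF h] c_nonzero[OF run'] by (simp add: t_def)
    have us: "coord u (s i) = 1" using eq[OF sn[OF i]] dual_self[OF i] dual_other[OF i' i] by simp
    have "coord u (s ?i) = - t" using eq[OF sn[OF i']] dual_self[OF i'] dual_other[OF i i'] by simp
    \<comment> \<open>By \<open>c_pos\<close> the two entries at \<open>s b + 1\<close> are nonzero
      of opposite sign, the exponents \<open>b - i\<close> and \<open>b - ?i\<close> differing by
      one.\<close>
    moreover have "t < 0"
    proof -
      have "b - i = Suc (b - ?i)" using False b by simp
      then have "(-1) ^ (b - ?i) * coord (dual i) (s b + 1) < 0" using c_pos[OF run] by simp
      then have "((-1) ^ (b - ?i) * coord (dual i) (s b + 1)) / ((-1) ^ (b - ?i) * coord (dual ?i) (s b + 1)) < 0"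
        using c_pos[OF run'] by (rule divide_neg_pos)
      then show ?thesis by (simp add: t_def)
    qed
    ultimately have uS: "coord u (s i + 1) > 0" using si by simp
    have supp: "coord u l = 0" if l: "l \<in> {1..n}" "l \<notin> {s i, s i + 1, n}" for l
    proof (cases "l = s b + 1")
      case False
      then show ?thesis using eq[OF l(1)] dual_support[OF run l(1)] dual_support[OF run' l(1)] l si by simp
    qed (use uh in simp)
    have "coord u (s l) = 0" if "l \<in> {1..k}" "l \<noteq> i" "l \<noteq> ?i" for l
      using eq[OF sn[OF that(1)]] dual_other[OF i that(1,2)] dual_other[OF i' that(1,3)] by simp
    \<comment> \<open>\<open>u\<close> is nonzero at \<open>s ?i\<close> but zero at
      \<open>s b + 1\<close>, which suits the basis with \<open>s ?i\<close> exchanged; as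
      \<open>i < ?i\<close>, the parity stays \<open>k - i\<close>.\<close>
    then have "(-1) ^ (k - i) * coord u n \<ge> 0"
      using sign_exchanged[OF run' c_nonzero[OF run'] i b(2) _ uV us uh] by simp
    then show ?thesis using uV us uS supp by (intro bexI[of _ u]) auto
  qed
  then obtain u where u: "u \<in> V" "\<forall>l\<in>{1..n}. l \<notin> {s i, s i + 1, n} \<longrightarrow> coord u l = 0"
    "coord u (s i) = 1" "coord u (s i + 1) > 0" "(-1) ^ (k - i) * coord u n \<ge> 0" by blast
  have "coord u n \<noteq> 0" using coord_n_nonzero[OF u(1) i] u by auto
  then have "(-1) ^ (k - i) * coord u n > 0" using u(5) by (simp add: less_le)
  then show ?thesis using u by (intro bexI[of _ u]) auto
qed

end

section \<open>The equivalence\<close>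

lemma Gr_subspace:
  assumes "V \<in> Gr k n"
  shows "V \<subseteq> carrier_vec n" "submodule class_ring V (Rn n)" "vectorspace class_ring (subspace_vs n V)"
    "vectorspace.dim class_ring (subspace_vs n V) = k"
proof -
  interpret vec_space "TYPE(real)" n .
  have sub: "VectorSpace.subspace class_ring V (Rn n)" and "vectorspace.dim class_ring (subspace_vs n V) = k"
    using assms by (auto simp: Gr_def)
  then show "vectorspace.dim class_ring (subspace_vs n V) = k" by simp
  show sm: "submodule class_ring V (Rn n)" using sub by (simp add: subspace_def)
  then show "V \<subseteq> carrier_vec n" using submodule.subset[OF sm] by simp
  show "vectorspace class_ring (subspace_vs n V)" by (rule subspace_is_vs[OF sub])
qed

lemma set_rows_row_mat:
  assumes "\<And>i. i \<in> {1..k} \<Longrightarrow> v i \<in> carrier_vec n"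
  shows "set (rows (row_mat k n v)) = v ` {1..k}"
proof -
  have "row (row_mat k n v) i = v (Suc i)" if "i < k" for i
    using that assms[of "Suc i"] by (auto simp: row_mat_def)
  then have "set (rows (row_mat k n v)) = (\<lambda>i. v (Suc i)) ` {..<k}"
    by (auto simp: rows_def row_mat_def)
  also have "\<dots> = v ` (Suc ` {..<k})" by (simp add: image_image)
  also have "Suc ` {..<k} = {1..k}" by (simp add: lessThan_atLeast0 image_Suc_atLeastLessThan atLeastLessThanSuc_atLeastAtMost)
  finally show ?thesis .
qed

lemma represents_if_basis:
  assumes V: "V \<in> Gr k n" and basis: "vectorspace.basis class_ring (subspace_vs n V) (v ` {1..k})"
  shows "v ` {1..k} \<subseteq> V" "represents k n (row_mat k n v) V"
proof -
  interpret vec_space "TYPE(real)" n .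
  interpret W: vectorspace class_ring "subspace_vs n V" by (rule Gr_subspace(3)[OF V])
  show sub: "v ` {1..k} \<subseteq> V" using basis by (simp add: W.basis_def)
  then have "span (v ` {1..k}) = V"
    using basis span_li_not_depend(1)[OF sub Gr_subspace(2)[OF V]] by (simp add: W.basis_def)
  moreover have "set (rows (row_mat k n v)) = v ` {1..k}"
    by (rule set_rows_row_mat) (use sub Gr_subspace(1)[OF V] in blast)
  ultimately show "represents k n (row_mat k n v) V"
    by (simp add: represents_def row_space_def row_mat_def)
qed

context staircase_vectors begin

text \<open>For \<open>i < j\<close> the two vectors differ at \<open>s i\<close>, where
  \<open>v j\<close> vanishes.\<close>

lemma inj_on_v: "inj_on v {1..k}"
proof (rule inj_onI)
  have "v i \<noteq> v j" if "i \<in> {1..k}" "j \<in> {1..k}" "i < j" for i j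
  proof
    assume "v i = v j"
    moreover have "coord (v j) (s i) = 0"
    proof (rule ccontr)
      assume "coord (v j) (s i) \<noteq> 0"
      then have "s i = s j + 1" using v_at_s[of j i] that by auto
      then show False using s_less_iff[of i j] that by auto
    qed
    ultimately show False using v_s[of i] that by simp
  qed
  then show "i = j" if "i \<in> {1..k}" "j \<in> {1..k}" "v i = v j" for i j
    using that by (metis linorder_neqE_nat)
qed

text \<open>Independence is forward substitution applied to the zero vector, and \<open>k\<close>
  independent members of a \<open>k\<close>-dimensional space form a basis. The rows of
  \<open>A\<close> witness finite dimension.\<close>

lemma basis_if_members:
  assumes V: "V \<in> Gr k n" and rep: "represents k n A V" and mem: "\<And>i. i \<in> {1..k} \<Longrightarrow> v i \<in> V"
  shows "vectorspace.basis class_ring (subspace_vs n V) (v ` {1..k})"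
proof -
  interpret vec_space "TYPE(real)" n .
  interpret W: vectorspace class_ring "subspace_vs n V" by (rule Gr_subspace(3)[OF V])
  have A: "A \<in> carrier_mat k n" and rA: "V = span (set (rows A))"
    using rep by (auto simp: represents_def row_space_def)
  have vc: "v i \<in> carrier_vec n" if "i \<in> {1..k}" for i using mem[OF that] Gr_subspace(1)[OF V] by auto
  have sub: "v ` {1..k} \<subseteq> V" using mem by auto
  let ?B = "row_mat k n v"
  have B: "?B \<in> carrier_mat k n" by (simp add: row_mat_def)
  have rows: "set (rows ?B) = v ` {1..k}" using vc by (rule set_rows_row_mat)
  have card: "card (v ` {1..k}) = k" using inj_on_v by (simp add: card_image)
  then have "distinct (rows ?B)" using rows B by (intro card_distinct) auto
  then have dist: "distinct (cols ?B\<^sup>T)" by simp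
  have "lin_indpt (v ` {1..k})"
  proof
    assume "lin_dep (v ` {1..k})"
    then have "lin_dep (set (cols ?B\<^sup>T))" using rows by simp
    then obtain y where y: "y \<in> carrier_vec k" "y \<noteq> 0\<^sub>v k" "?B\<^sup>T *\<^sub>v y = 0\<^sub>v n"
      using lin_depE[of "?B\<^sup>T" k] B dist by auto
    have "coord (0\<^sub>v n) l = (\<Sum>i=1..k. y $ (i - 1) * coord (v i) l)" if l: "l \<in> {1..n}" for l
    proof -
      have "coord (0\<^sub>v n) l = (?B\<^sup>T *\<^sub>v y) $ (l - 1)" using y(3) by simp
      also have "\<dots> = (\<Sum>i<k. v (Suc i) $ (l - 1) * y $ i)"
      proof -
        have "l - 1 < n" using l by auto
        then show ?thesis using y(1) by (simp add: row_mat_def scalar_prod_def lessThan_atLeast0)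
      qed
      also have "\<dots> = (\<Sum>i=1..k. y $ (i - 1) * coord (v i) l)"
        by (simp add: sum.atLeast1_atMost_eq mult.commute)
      finally show ?thesis .
    qed
    moreover have "coord (0\<^sub>v n) (s l) = (0 :: real)" if "l \<in> {1..k}" for l
      using s_pos[of l] s_Suc_less[OF that] that by auto
    ultimately have "y $ (l - 1) = 0" if "l \<in> {1..k}" for l
      using coeffs_zero_upward[of "0\<^sub>v n" "\<lambda>i. y $ (i - 1)" k l] that by blast
    then have "y $ i = 0" if "i < k" for i using that by (metis Suc_leI atLeastAtMost_iff diff_Suc_1 le_add1 plus_1_eq_Suc)
    then show False using y(1,2) by (auto simp: vec_eq_iff)
  qed
  then have li: "W.lin_indpt (v ` {1..k})"
    using span_li_not_depend(2)[OF sub Gr_subspace(2)[OF V]] by simp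
  have "set (rows A) \<subseteq> carrier_vec n" using A rows_carrier by blast
  then have rsub: "set (rows A) \<subseteq> V" unfolding rA by (rule in_own_span)
  have "W.span (set (rows A)) = V"
    using span_li_not_depend(1)[OF rsub Gr_subspace(2)[OF V]] rA by simp
  then have "W.fin_dim" unfolding W.fin_dim_def using rsub by (intro exI[of _ "set (rows A)"]) auto
  then show ?thesis
    using sub li card Gr_subspace(4)[OF V] by (intro W.dim_li_is_basis) auto
qed

end

text \<open>Serves the case \<open>n = 0\<close>, which the locales exclude; there \<open>V\<close>
  is the zero space.\<close>

lemma Gr_0_0:
  assumes "V \<in> Gr 0 0"
  shows "represents 0 0 (mat 0 0 f) V" "vectorspace.basis class_ring (subspace_vs 0 V) {}"
proof -
  interpret vec_space "TYPE(real)" 0 .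
  interpret W: vectorspace class_ring "subspace_vs 0 V" by (rule Gr_subspace(3)[OF assms])
  have "0\<^sub>v 0 \<in> V" using W.zero_closed by simp
  moreover have "x = 0\<^sub>v 0" if "x \<in> V" for x
  proof -
    have "x \<in> carrier_vec 0" using that Gr_subspace(1)[OF assms] by blast
    then have "dim_vec x = 0" by (rule carrier_vecD)
    then show ?thesis by simp
  qed
  ultimately have V: "V = {0\<^sub>v 0}" by blast
  have sp: "span {} = V" by (simp add: span_empty V)
  have "rows (mat 0 0 f :: real mat) = []" by (simp add: rows_def)
  then show "represents 0 0 (mat 0 0 f) V" by (simp add: represents_def row_space_def sp)
  have "W.span {} = V" using span_li_not_depend(1)[OF _ Gr_subspace(2)[OF assms], of "{}"] sp by simp
  then show "vectorspace.basis class_ring (subspace_vs 0 V) {}"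
    using Gr_subspace(4)[OF assms] by (intro W.dim_gen_is_basis) auto
qed

text \<open>Both functions enumerate the same finite set increasingly, and \<open>pick\<close> gives
  their common values.\<close>

lemma (in two_plus_diagram) enumeration_eq_vlabel:
  assumes "strict_mono_on {1..k} s" "s ` {1..k} = vertical_labels k n D" "i \<in> {1..k}"
  shows "s i = vlabel i"
proof -
  have Suc_image: "Suc ` {..<k} = {1..k}"
    by (simp add: lessThan_atLeast0 image_Suc_atLeastLessThan atLeastLessThanSuc_atLeastAtMost)
  have "strict_mono_on {..<k} (s \<circ> Suc)" "strict_mono_on {..<k} (vlabel \<circ> Suc)"
    using s_strict_mono by (auto intro!: strict_mono_onI strict_mono_onD[OF assms(1)] simp: strict_mono_on_def)
  note pick = this[THEN pick_image_strict_mono]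
  have "(s \<circ> Suc) ` {..<k} = (vlabel \<circ> Suc) ` {..<k}"
    using assms(2) S_eq unfolding image_comp[symmetric] Suc_image by simp
  then have "(s \<circ> Suc) (i - 1) = (vlabel \<circ> Suc) (i - 1)"
    using pick(1)[of "i - 1"] pick(2)[of "i - 1"] assms(3) by auto
  then show ?thesis using assms(3) by auto
qed

theorem lemma4p10:
  fixes n k :: nat and D :: diagram and s :: "nat \<Rightarrow> nat" and V :: "real vec set"
  assumes "D \<in> Dnk2 n k"
    and "strict_mono_on {1..k} s"
    and "s ` {1..k} = vertical_labels k n D"
    and "V \<in> Gr k n"
  shows "V \<in> diagram_cell k n D \<longleftrightarrow>
    (\<exists>v :: nat \<Rightarrow> real vec.
       inj_on v {1..k} \<and>
       vectorspace.basis class_ring (subspace_vs n V) (v ` {1..k}) \<and>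
       (\<forall>i \<in> {1..k}.
          (\<forall>j \<in> {1..n}. j \<notin> {s i, s i + 1, n} \<longrightarrow> coord (v i) j = 0) \<and>
          coord (v i) (s i) > 0 \<and>
          coord (v i) (s i + 1) > 0 \<and>
          (-1) ^ (k - i) * coord (v i) n > 0))"
proof (cases "n = 0")
  case True
  then have "k = 0" using assms(1) by (simp add: Dnk2_def oplus_diagram_def)
  then have V: "V \<in> Gr 0 0" using assms(4) True by simp
  \<comment> \<open>The only minor to check is the determinant of the empty matrix.\<close>
  have "\<exists>A. represents 0 0 A V \<and> (\<forall>J\<subseteq>{..<0}. card J = 0 \<longrightarrow> 0 \<le> det (submatrix A UNIV J))"
    using Gr_0_0(1)[OF V, of "\<lambda>_. 0"] by (intro exI conjI) (auto simp: submatrix_def)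
  then have "V \<in> diagram_cell k n D" using V True \<open>k = 0\<close>
    by (simp add: diagram_cell_def positroid_cell_def Gr_nonneg_def dperm_of_def dperm_of_mat_def
        dperm_of_diagram_def)
  then show ?thesis using Gr_0_0(2)[OF V] True \<open>k = 0\<close> by simp
next
  case False
  interpret two_plus_diagram n k D by unfold_locales (use assms False in auto)
  have s: "s i = vlabel i" if "i \<in> {1..k}" for i
    using enumeration_eq_vlabel[OF assms(2,3) that] .
  have cell: "V \<in> diagram_cell k n D \<longleftrightarrow> V \<in> Gr_nonneg k n \<and> dperm_of k n V = dperm_of_diagram k n D"
    by (simp add: diagram_cell_def positroid_cell_def)
  show ?thesis
  proof
    assume "V \<in> diagram_cell k n D"
    then obtain A where A: "represents k n A V" "\<forall>J\<subseteq>{..<n}. card J = k \<longrightarrow> det (submatrix A UNIV J) \<ge> 0"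
      and "dperm_of k n V = dperm_of_diagram k n D" unfolding cell Gr_nonneg_def by blast
    then have ret: "\<forall>i\<in>{1..n}. return_index n V i = target i" using dperm_of_eq_iff by blast
    interpret staircase_cell n k vlabel V A
      by unfold_locales (use A ret Gr_subspace(4)[OF assms(4)] in auto)
    obtain v where v: "\<forall>i\<in>{1..k}. v i \<in> V \<and>
        (\<forall>l\<in>{1..n}. l \<notin> {vlabel i, vlabel i + 1, n} \<longrightarrow> coord (v i) l = 0) \<and>
        coord (v i) (vlabel i) > 0 \<and> coord (v i) (vlabel i + 1) > 0 \<and> (-1) ^ (k - i) * coord (v i) n > 0"
      using bchoice[of "{1..k}"] staircase_vector_exists by (metis (no_types, lifting))
    interpret staircase_vectors n k vlabel v
      by unfold_locales (use v in blast)+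
    show "\<exists>v. inj_on v {1..k} \<and> vectorspace.basis class_ring (subspace_vs n V) (v ` {1..k}) \<and>
        (\<forall>i\<in>{1..k}. (\<forall>j\<in>{1..n}. j \<notin> {s i, s i + 1, n} \<longrightarrow> coord (v i) j = 0) \<and>
          coord (v i) (s i) > 0 \<and> coord (v i) (s i + 1) > 0 \<and> (-1) ^ (k - i) * coord (v i) n > 0)"
    proof (intro exI conjI)
      show "inj_on v {1..k}" by (rule inj_on_v)
      show "vectorspace.basis class_ring (subspace_vs n V) (v ` {1..k})"
        using v by (intro basis_if_members[OF assms(4) A(1)]) blast
    qed (use v s in auto)
  next
    assume "\<exists>v. inj_on v {1..k} \<and> vectorspace.basis class_ring (subspace_vs n V) (v ` {1..k}) \<and>
        (\<forall>i\<in>{1..k}. (\<forall>j\<in>{1..n}. j \<notin> {s i, s i + 1, n} \<longrightarrow> coord (v i) j = 0) \<and>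
          coord (v i) (s i) > 0 \<and> coord (v i) (s i + 1) > 0 \<and> (-1) ^ (k - i) * coord (v i) n > 0)"
    then obtain v where basis: "vectorspace.basis class_ring (subspace_vs n V) (v ` {1..k})"
      and v: "\<forall>i\<in>{1..k}. (\<forall>j\<in>{1..n}. j \<notin> {vlabel i, vlabel i + 1, n} \<longrightarrow> coord (v i) j = 0) \<and>
          coord (v i) (vlabel i) > 0 \<and> coord (v i) (vlabel i + 1) > 0 \<and> (-1) ^ (k - i) * coord (v i) n > 0"
      using s by auto
    interpret staircase_vectors n k vlabel v
      by unfold_locales (use v in blast)+
    note rep = represents_if_basis[OF assms(4) basis]
    have "V \<in> Gr_nonneg k n"
      using assms(4) rep(2) minor_nonneg by (auto simp: Gr_nonneg_def)
    moreover have "v i \<in> carrier_vec n" if "i \<in> {1..k}" for i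
      using rep(1) Gr_subspace(1)[OF assms(4)] that by blast
    then have "\<forall>i\<in>{1..n}. return_index n V i = target i"
      using return_index_eq_target[OF rep(2)] by blast
    then have "dperm_of k n V = dperm_of_diagram k n D" using dperm_of_eq_iff[OF rep(2)] by blast
    ultimately show "V \<in> diagram_cell k n D" unfolding cell by blast
  qed
qed

end
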